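(* Every $2$-connected subcubic outerplanar graph $G$ is packing $(1,1,2)$-colorable.
   Context: A graph is subcubic if its maximum degree is at most $3$. For a non-decreasing sequence $S=(s_1,\dots,s_k)$ of positive integers, a packing $S$-coloring of a graph $G$ is a partition of $V(G)$ into sets $V_1,\dots,V_k$ (some possibly empty) such that, for each $1\le i\le k$, the distance in $G$ between any two distinct vertices $x,y\in V_i$ is at least $s_i+1$. $G$ is packing $S$-colorable if it has a packing $S$-coloring. *)

theory Defs
  imports
    "HOL-Analysis.Analysis"
    "Graph_Theory.Digraph_Component"
    "Graph_Theory.Shortest_Path"
begin

text \<open>
  Finite simple graphs are the locale \<^locale>\<open>graph\<close> (finite, loop-free digraphs without
  parallel arcs, with symmetric adjacency): an undirected edge is represented by a pair of
  opposite arcs. Hence the degree of a vertex is its out-degree, and the undirected edges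
  are the following two-element sets.
\<close>

definition edges :: "('a, 'b) pre_digraph \<Rightarrow> 'a set set" where
  "edges G = {{u, v} |u v. (u, v) \<in> arcs_ends G}"

definition subcubic :: "('a, 'b) pre_digraph \<Rightarrow> bool" where
  "subcubic G \<longleftrightarrow> (\<forall>v \<in> verts G. out_degree G v \<le> 3)"

definition two_connected :: "('a, 'b) pre_digraph \<Rightarrow> bool" where
  "two_connected G \<longleftrightarrow>
     card (verts G) \<ge> 3 \<and> Digraph_Component.connected G \<and>
     (\<forall>v \<in> verts G. Digraph_Component.connected (pre_digraph.del_vert G v))"

text \<open>
  Drawings in the plane: \<open>p\<close> places the vertices, \<open>\<gamma>\<close> draws each edge as an arc
  (an injective continuous curve) joining its ends. The interior of an arc contains neither
  a vertex nor a point of another edge.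
\<close>

definition plane_drawing ::
    "('a, 'b) pre_digraph \<Rightarrow> ('a \<Rightarrow> complex) \<Rightarrow> ('a set \<Rightarrow> real \<Rightarrow> complex) \<Rightarrow> bool" where
  "plane_drawing G p \<gamma> \<longleftrightarrow>
     inj_on p (verts G) \<and>
     (\<forall>e \<in> edges G. arc (\<gamma> e) \<and> {pathstart (\<gamma> e), pathfinish (\<gamma> e)} = p ` e \<and>
        (path_image (\<gamma> e) - p ` e) \<inter> p ` verts G = {} \<and>
        (\<forall>f \<in> edges G. f \<noteq> e \<longrightarrow> (path_image (\<gamma> e) - p ` e) \<inter> path_image (\<gamma> f) = {}))"

definition drawing_points ::
    "('a, 'b) pre_digraph \<Rightarrow> ('a \<Rightarrow> complex) \<Rightarrow> ('a set \<Rightarrow> real \<Rightarrow> complex) \<Rightarrow> complex set" where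
  "drawing_points G p \<gamma> = p ` verts G \<union> (\<Union>e \<in> edges G. path_image (\<gamma> e))"

text \<open>
  As the points of a drawing form a bounded set, \<^const>\<open>outside\<close> yields its unique unbounded
  face.
\<close>

definition outerplanar :: "('a, 'b) pre_digraph \<Rightarrow> bool" where
  "outerplanar G \<longleftrightarrow>
     (\<exists>p \<gamma>. plane_drawing G p \<gamma> \<and>
        p ` verts G \<subseteq> frontier (outside (drawing_points G p \<gamma>)))"

text \<open>
  The distance is the least number of arcs of a walk, and \<open>\<infinity>\<close> if there is none.
\<close>

definition graph_dist :: "('a, 'b) pre_digraph \<Rightarrow> 'a \<Rightarrow> 'a \<Rightarrow> ereal" where
  "graph_dist G x y = wf_digraph.\<mu> G (\<lambda>_. 1) x y"

text \<open>
  A sequence \<open>S = (s\<^sub>1, \<dots>, s\<^sub>k)\<close> is a list, so the class \<open>V i\<close> belongs to the entry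
  \<open>S ! i = s\<^sub>i\<^sub>+\<^sub>1\<close>. Classes may be empty.
\<close>

definition packing_coloring :: "('a, 'b) pre_digraph \<Rightarrow> nat list \<Rightarrow> (nat \<Rightarrow> 'a set) \<Rightarrow> bool" where
  "packing_coloring G S V \<longleftrightarrow>
     (\<Union>i<length S. V i) = verts G \<and>
     disjoint_family_on V {..<length S} \<and>
     (\<forall>i<length S. \<forall>x \<in> V i. \<forall>y \<in> V i. x \<noteq> y \<longrightarrow> graph_dist G x y \<ge> ereal (real (S ! i + 1)))"

definition packing_colorable :: "('a, 'b) pre_digraph \<Rightarrow> nat list \<Rightarrow> bool" where
  "packing_colorable G S \<longleftrightarrow> (\<exists>V. packing_coloring G S V)"

end

theory Submission
  imports Defs
begin

text \<open>
  The graph has a Hamiltonian cycle: if a longest cycle missed a vertex, a path through this vertex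
  with both ends on the cycle would either yield a longer cycle or three internally disjoint paths
  of length at least two between two vertices, and one of these paths would be drawn inside the
  cycle formed by the other two. Likewise all chords are drawn inside the Hamiltonian cycle, so they
  do not cross, and as the graph is subcubic, they form a matching.

  A class with pairwise distances at least \<open>3\<close> whose removal leaves a bipartite graph is built
  face by face. Let a chord \<open>ab\<close> cut off a piece of the graph. Call the piece free if it has a
  colouring that uses the third class neither on \<open>a\<close>, \<open>b\<close> nor on their neighbours in the piece,
  and tight if it has colourings with only \<open>a\<close>, with only \<open>b\<close>, and with none of \<open>a\<close>, \<open>b\<close> in the
  third class. By induction, every piece is free or tight. Consider the face of the piece at \<open>ab\<close>.
  If it is even, colour it alternately, and the
  piece is free. If it is odd and meets a tight chord, some end of a tight chord
  has a neighbour on the face that is not on a tight chord; this end goes into the third class and the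
  piece is free. If it is odd and meets no tight chord, then \<open>a\<close>, or \<open>b\<close>, or any vertex of the face
  not on a chord can be put into the third class, and the piece is tight. Finally the two
  pieces on both sides of a chord fit together.
\<close>

section \<open>Colouring intervals with a noncrossing matching\<close>

text \<open>Numbers stand for positions along a path; consecutive ones are adjacent anyway, so
  \<open>M\<close> records only the chords. The case \<open>i = j\<close> of \<open>far\<close>
  makes \<open>M\<close> irreflexive, and \<open>uniq\<close> is what a degree bound of three
  leaves: at most one chord per vertex.\<close>

locale chords =
  fixes M :: "nat \<Rightarrow> nat \<Rightarrow> bool"
  assumes sym: "M i j \<Longrightarrow> M j i"
    and far: "M i j \<Longrightarrow> i \<le> j \<Longrightarrow> Suc i < j"
    and uniq: "M i j \<Longrightarrow> M i k \<Longrightarrow> j = k"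
    and nocross: "M i j \<Longrightarrow> M k l \<Longrightarrow> i < k \<Longrightarrow> k < j \<Longrightarrow> j < l \<Longrightarrow> False"
begin

definition adj :: "nat \<Rightarrow> nat \<Rightarrow> bool" where
  "adj i j \<longleftrightarrow> j = Suc i \<or> i = Suc j \<or> M i j"

text \<open>The colour \<^const>\<open>None\<close> stands for the class with pairwise distances at least \<open>3\<close>.\<close>

definition valid_on :: "(nat \<Rightarrow> bool option) \<Rightarrow> nat \<Rightarrow> nat \<Rightarrow> bool" where
  "valid_on c x y \<longleftrightarrow> (\<forall>i\<in>{x..<y}. \<forall>j\<in>{x..<y}. adj i j \<longrightarrow> c i \<noteq> c j) \<and>
     (\<forall>i\<in>{x..<y}. \<forall>j\<in>{x..<y}. \<forall>k\<in>{x..<y}.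
        adj i j \<longrightarrow> adj i k \<longrightarrow> c j = None \<longrightarrow> c k = None \<longrightarrow> j = k)"

text \<open>An exposed vertex already has a neighbour coloured \<open>None\<close>, so no vertex
  joined to it later may get \<open>None\<close>. Besides the colours at the seam, this is all that
  gluing has to know about a coloured interval.\<close>

definition exposed :: "(nat \<Rightarrow> bool option) \<Rightarrow> nat \<Rightarrow> nat \<Rightarrow> nat \<Rightarrow> bool" where
  "exposed c x y i \<longleftrightarrow> (\<exists>j\<in>{x..<y}. adj i j \<and> c j = None)"

lemma valid_onD_proper: "valid_on c x y \<Longrightarrow> adj i j \<Longrightarrow> x \<le> i \<Longrightarrow> i < y \<Longrightarrow> x \<le> j \<Longrightarrow> j < y \<Longrightarrow> c i \<noteq> c j"
  unfolding valid_on_def by (meson atLeastLessThan_iff)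

lemma valid_onD_far: "valid_on c x y \<Longrightarrow> adj i j \<Longrightarrow> adj i k \<Longrightarrow> x \<le> i \<Longrightarrow> i < y \<Longrightarrow> x \<le> j \<Longrightarrow> j < y \<Longrightarrow>
    x \<le> k \<Longrightarrow> k < y \<Longrightarrow> c j = None \<Longrightarrow> c k = None \<Longrightarrow> j = k"
  unfolding valid_on_def by (meson atLeastLessThan_iff)

lemma adj_sym: "adj i j \<Longrightarrow> adj j i"
  using sym by (auto simp: adj_def)

text \<open>\<open>map_option Not\<close> exchanges the two Boolean classes and fixes
  \<open>None\<close>. Hence the Boolean at one vertex can be prescribed without moving the third
  class.\<close>

lemma valid_on_swap: "valid_on (map_option Not \<circ> c) x y \<longleftrightarrow> valid_on c x y"
proof -
  have "map_option Not a = map_option Not b \<longleftrightarrow> a = b" for a b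
    by (cases a; cases b) auto
  then show ?thesis by (simp add: valid_on_def)
qed

text \<open>Without a chord across the seam, \<open>w\<close> and \<open>Suc w\<close> are the only
  adjacent pair between the two intervals. Two \<open>None\<close> vertices on different sides with
  a common neighbour would have to use this pair, which \<open>l\<close> and \<open>r\<close>
  forbid.\<close>

lemma valid_on_glue:
  assumes c: "valid_on c x (Suc w)" and d: "valid_on d (Suc w) z" and "x \<le> w" "Suc w < z"
    and M: "\<And>i j. i \<le> w \<Longrightarrow> w < j \<Longrightarrow> j < z \<Longrightarrow> x \<le> i \<Longrightarrow> \<not> M i j"
    and ne: "c w \<noteq> d (Suc w)"
    and l: "d (Suc w) = None \<Longrightarrow> \<not> exposed c x (Suc w) w"
    and r: "c w = None \<Longrightarrow> \<not> exposed d (Suc w) z (Suc w)"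
  shows "valid_on (\<lambda>i. if i \<le> w then c i else d i) x z" (is "valid_on ?e x z")
proof -
  have cross: "i = w \<and> j = Suc w" if "x \<le> i" "i \<le> w" "w < j" "j < z" "adj i j" for i j
    using that M[of i j] by (auto simp: adj_def)
  have proper: "?e i \<noteq> ?e j" if "x \<le> i" "i < j" "j < z" "adj i j" for i j
  proof -
    consider "j \<le> w" | "w < i" | "i \<le> w" "w < j" by linarith
    then show ?thesis
    proof cases
      case 1 then show ?thesis using valid_onD_proper[OF c, of i j] that by auto
    next
      case 2 then show ?thesis using valid_onD_proper[OF d, of i j] that by auto
    next
      case 3 then show ?thesis using cross[of i j] that ne by auto
    qed
  qed
  have irr: "\<not> adj i i" for i using far[of i i] by (auto simp: adj_def)
  have 1: "?e i \<noteq> ?e j" if "i \<in> {x..<z}" "j \<in> {x..<z}" "adj i j" for i j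
    using proper[of i j] proper[of j i] that adj_sym[of i j] irr[of i]
    by (cases i j rule: linorder_cases) (auto simp: eq_commute)
  \<comment> \<open>Symmetry in \<open>j\<close> and \<open>k\<close> halves the cases;
    \<open>l\<close> and \<open>r\<close> are called where the seam separates \<open>j\<close> from
    \<open>k\<close>.\<close>
  have two: "j = k" if "i \<in> {x..<z}" "j \<in> {x..<z}" "k \<in> {x..<z}" "adj i j" "adj i k" "?e j = None" "?e k = None"
    "j \<le> k" for i j k
  proof (rule ccontr)
    assume "j \<noteq> k"
    consider "i \<le> w" "k \<le> w" | "i \<le> w" "j \<le> w" "w < k" | "i \<le> w" "w < j"
      | "w < i" "w < j" | "w < i" "j \<le> w" "w < k" | "w < i" "k \<le> w" by linarith
    then show False
    proof cases
      case 1
      then have "j \<le> w" using \<open>j \<le> k\<close> by simp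
      then show False using valid_onD_far[OF c, of i j k] 1 that \<open>j \<noteq> k\<close> by auto
    next
      case 2
      then have "i = w" "k = Suc w" using cross[of i k] that by auto
      then show False using l that 2 by (auto simp: exposed_def)
    next
      case 3
      then show False using cross[of i j] cross[of i k] that \<open>j \<noteq> k\<close> by auto
    next
      case 4
      then have "w < k" using \<open>j \<le> k\<close> by simp
      then show False using valid_onD_far[OF d, of i j k] 4 that \<open>j \<noteq> k\<close> by auto
    next
      case 5
      then have "i = Suc w" "j = w" using cross[of j i] that adj_sym[of i j] by auto
      then show False using r that 5 by (auto simp: exposed_def)
    next
      case 6
      then show False using cross[of j i] cross[of k i] that adj_sym[of i j] adj_sym[of i k] \<open>j \<noteq> k\<close> by auto
    qed
  qed
  have 2: "j = k" if "i \<in> {x..<z}" "j \<in> {x..<z}" "k \<in> {x..<z}" "adj i j" "adj i k" "?e j = None" "?e k = None"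
    for i j k
    using two[of i j k] two[of i k j] that by (cases "j \<le> k") auto
  show ?thesis unfolding valid_on_def using 1 2 by blast
qed

text \<open>The new vertex \<open>b\<close> completes the face at the chord: by \<open>uniq\<close>
  its only neighbours in the interval are \<open>a\<close> and \<open>v\<close>. So \<open>l\<close>
  protects these two from a second \<open>None\<close> neighbour, and \<open>r\<close> protects
  \<open>b\<close>.\<close>

lemma valid_on_close:
  assumes c: "valid_on c a b" and ab: "M a b" "Suc a < b" and b: "b = Suc v"
    and ne: "e \<noteq> c a" "e \<noteq> c v"
    and l: "e = None \<Longrightarrow> \<not> exposed c a b a \<and> \<not> exposed c a b v"
    and r: "\<not> (c a = None \<and> c v = None)"
  shows "valid_on (c(b := e)) a (Suc b)" (is "valid_on ?e a _")
proof -
  have adj_b: "i = a \<or> i = v" if "adj b i \<or> adj i b" "a \<le> i" "i \<le> b" for i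
    using that b far[of b b] uniq[of b i a] sym[OF ab(1)] sym[of i b] by (auto simp: adj_def)
  have in': "i = b \<or> i \<in> {a..<b}" if "i \<in> {a..<Suc b}" for i using that by auto
  have av: "a \<noteq> v" "a < b" "v < b" "a < v" using ab b by auto
  have irr: "\<not> adj i i" for i using far[of i i] by (auto simp: adj_def)
  have 1: "?e i \<noteq> ?e j" if "i \<in> {a..<Suc b}" "j \<in> {a..<Suc b}" "adj i j" for i j
    using in'[OF that(1)] in'[OF that(2)]
  proof (elim disjE)
    assume "i = b" "j = b" then show ?thesis using irr that by auto
  next
    assume "i = b" "j \<in> {a..<b}" then show ?thesis using adj_b[of j] that ne by auto
  next
    assume "j = b" "i \<in> {a..<b}" then show ?thesis using adj_b[of i] that ne by auto
  next
    assume "i \<in> {a..<b}" "j \<in> {a..<b}" then show ?thesis using valid_onD_proper[OF c, of i j] that(3) by auto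
  qed
  have two: "j = k" if "i \<in> {a..<Suc b}" "j \<in> {a..<b}" "k \<in> {a..<Suc b}" "adj i j" "adj i k" "?e j = None" "?e k = None"
    for i j k
  proof (cases "i = b")
    case True
    then have "k \<noteq> b" using irr that by auto
    then have "j = a \<or> j = v" "k = a \<or> k = v" using adj_b[of j] adj_b[of k] that True by auto
    then show ?thesis using that r av by auto
  next
    case False
    then have i: "i \<in> {a..<b}" using in' that by blast
    show ?thesis
    proof (cases "k = b")
      case True
      then have "i = a \<or> i = v" using adj_b[of i] that i by auto
      moreover have "e = None" "c j = None" using True that av by (auto split: if_splits)
      ultimately show ?thesis using that(2,4) l by (auto simp: exposed_def)
    next
      case False
      then have "k \<in> {a..<b}" using in' that by blast
      then show ?thesis using i that False valid_onD_far[OF c, of i j k] by auto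
    qed
  qed
  have 2: "j = k" if "i \<in> {a..<Suc b}" "j \<in> {a..<Suc b}" "k \<in> {a..<Suc b}" "adj i j" "adj i k" "?e j = None" "?e k = None"
    for i j k
    using two[of i j k] two[of i k j] in'[OF that(2)] in'[OF that(3)] that by metis
  show ?thesis unfolding valid_on_def using 1 2 by blast
qed

definition free_chord :: "nat \<Rightarrow> nat \<Rightarrow> bool" where
  "free_chord i j \<longleftrightarrow> (\<exists>c. valid_on c i (Suc j) \<and> c i \<noteq> None \<and> c j \<noteq> None \<and> c (Suc i) \<noteq> None \<and> c (j - 1) \<noteq> None)"

definition tight_chord :: "nat \<Rightarrow> nat \<Rightarrow> bool" where
  "tight_chord i j \<longleftrightarrow> (\<exists>c. valid_on c i (Suc j) \<and> c i = None \<and> c j \<noteq> None) \<and>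
     (\<exists>c. valid_on c i (Suc j) \<and> c i \<noteq> None \<and> c j = None) \<and>
     (\<exists>c. valid_on c i (Suc j) \<and> c i \<noteq> None \<and> c j \<noteq> None)"

end

section \<open>Words along the boundary of a face\<close>

datatype item = Single | Free | Tight

text \<open>Take the last \<open>x\<close>. If something follows it, that entry differs from
  \<open>x\<close>. Otherwise the list ends in a block of copies of \<open>x\<close>, and the first
  of them has a different entry before it. With \<open>Tight\<close> for \<open>x\<close> and
  \<open>Single\<close> for \<open>y\<close>, this finds a tight chord next to an item that is not
  tight.\<close>

lemma list_boundary:
  assumes "x \<in> set ws" "y \<in> set ws" "y \<noteq> x"
  shows "(\<exists>us vs. ws = us @ x # vs \<and> vs \<noteq> [] \<and> hd vs \<noteq> x) \<or>
    (\<exists>us vs. ws = us @ x # vs \<and> us \<noteq> [] \<and> last us \<noteq> x)"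
proof -
  obtain us vs where 1: "ws = us @ x # vs" "x \<notin> set vs"
    using split_list_last[OF assms(1)] by blast
  show ?thesis
  proof (cases "vs = []")
    case False
    then have "hd vs \<noteq> x" using 1 hd_in_set by metis
    then show ?thesis using 1 False by blast
  next
    case True
    then have "y \<in> set us" using 1 assms by auto
    then obtain us' z vs' where 2: "us = us' @ z # vs'" "z \<noteq> x" "\<forall>k\<in>set vs'. \<not> k \<noteq> x"
      using split_list_last_prop[of us "\<lambda>k. k \<noteq> x"] assms(3) by blast
    show ?thesis
    proof (cases vs')
      case Nil
      then show ?thesis using 1 2 by (intro disjI2 exI[of _ us] exI[of _ vs]) auto
    next
      case (Cons k ks)
      then have "ws = (us' @ [z]) @ x # (ks @ [x])" using 1 2 True by simp
      moreover have "last (us' @ [z]) \<noteq> x" using 2 by simp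
      ultimately show ?thesis by blast
    qed
  qed
qed

text \<open>
  \<open>word x ws y\<close> describes the part of the boundary of a face that runs through \<open>{x..<y}\<close>: single
  vertices without chord, and chords whose pieces lie beyond the face.
\<close>

inductive (in chords) word :: "nat \<Rightarrow> item list \<Rightarrow> nat \<Rightarrow> bool" where
  Nil: "word x [] x"
| Single: "(\<And>j. \<not> M x j) \<Longrightarrow> word (Suc x) ws y \<Longrightarrow> word x (Single # ws) y"
| Free: "M x j \<Longrightarrow> x < j \<Longrightarrow> free_chord x j \<Longrightarrow> word (Suc j) ws y \<Longrightarrow> word x (Free # ws) y"
| Tight: "M x j \<Longrightarrow> x < j \<Longrightarrow> tight_chord x j \<Longrightarrow> word (Suc j) ws y \<Longrightarrow> word x (Tight # ws) y"

context chords begin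

text \<open>A chord leaving from strictly inside would cross the chord \<open>x j\<close>; at an end
  of \<open>x j\<close>, \<open>uniq\<close> determines the partner.\<close>

lemma chord_closed:
  assumes "M x j" "x \<le> i" "i \<le> j" "M i k"
  shows "x \<le> k" "k \<le> j"
proof -
  have "x \<le> k \<and> k \<le> j"
  proof (rule ccontr)
    assume *: "\<not> (x \<le> k \<and> k \<le> j)"
    then have "i \<noteq> x" "i \<noteq> j" using uniq[of x j k] uniq[of j x k] sym[OF assms(1)] assms by auto
    then have "x < i" "i < j" using assms by auto
    then show False using * nocross[of x j i k] nocross[of k i x j] sym[of i k] assms by auto
  qed
  then show "x \<le> k" "k \<le> j" by auto
qed

lemma word_Nil_iff: "word x [] y \<longleftrightarrow> x = y"
proof
  assume "word x [] y" then show "x = y" by cases auto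
qed (simp add: word.Nil)

lemma word_mono: "word x ws y \<Longrightarrow> x \<le> y"
  by (induction rule: word.induct) auto

text \<open>This supplies the hypothesis of \<open>valid_on_glue\<close> that no chord crosses the
  seam, wherever a word is cut between two items.\<close>

lemma word_closed: "word x ws y \<Longrightarrow> x \<le> i \<Longrightarrow> i < y \<Longrightarrow> M i k \<Longrightarrow> x \<le> k \<and> k < y"
proof (induction arbitrary: i k rule: word.induct)
  case (Nil x) then show ?case by auto
next
  case (Single x ws y)
  then have "i \<noteq> x" by auto
  then show ?case using Single.IH[of i k] Single.prems by auto
next
  case (Free x j ws y)
  show ?case
  proof (cases "i \<le> j")
    case True
    then show ?thesis using chord_closed[of x j i k] Free word_mono[OF Free.hyps(4)] by auto
  next
    case False
    then show ?thesis using Free.IH[of i k] Free.prems Free.hyps by auto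
  qed
next
  case (Tight x j ws y)
  show ?case
  proof (cases "i \<le> j")
    case True
    then show ?thesis using chord_closed[of x j i k] Tight word_mono[OF Tight.hyps(4)] by auto
  next
    case False
    then show ?thesis using Tight.IH[of i k] Tight.prems Tight.hyps by auto
  qed
qed

lemma word_append: "word x (us @ vs) z \<Longrightarrow> \<exists>y. word x us y \<and> word y vs z"
proof (induction us arbitrary: x)
  case Nil then show ?case using word.Nil by auto
next
  case (Cons s us)
  from Cons.prems have "word x (s # us @ vs) z" by simp
  then show ?case
  proof cases
    case Single
    then obtain y where "word (Suc x) us y" "word y vs z" using Cons.IH by blast
    then show ?thesis using Single word.Single by blast
  next
    case (Free j)
    then obtain y where "word (Suc j) us y" "word y vs z" using Cons.IH by blast
    then show ?thesis using Free word.Free by blast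
  next
    case (Tight j)
    then obtain y where "word (Suc j) us y" "word y vs z" using Cons.IH by blast
    then show ?thesis using Tight word.Tight by blast
  qed
qed

text \<open>The first position either has no chord or starts one, since the interval is closed under
  \<open>M\<close>. What remains after this item is closed again, by \<open>chord_closed\<close>,
  and strong induction on the length applies.\<close>

lemma word_exists:
  assumes "\<And>i k. x \<le> i \<Longrightarrow> i < y \<Longrightarrow> M i k \<Longrightarrow> x \<le> k \<and> k < y" "x \<le> y"
    and "\<And>i j. x \<le> i \<Longrightarrow> i < j \<Longrightarrow> j < y \<Longrightarrow> M i j \<Longrightarrow> free_chord i j \<or> tight_chord i j"
  shows "\<exists>ws. word x ws y"
  using assms
proof (induction "y - x" arbitrary: x rule: less_induct)
  case less
  show ?case
  proof (cases "x = y")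
    case True then show ?thesis using word.Nil by auto
  next
    case False
    then have xy: "x < y" using less.prems(2) by simp
    show ?thesis
    proof (cases "\<exists>j. M x j")
      case False
      have "\<exists>ws. word (Suc x) ws y"
      proof (rule less.hyps)
        fix i k assume "Suc x \<le> i" "i < y" "M i k"
        moreover have "k \<noteq> x" using False \<open>M i k\<close> sym by blast
        ultimately show "Suc x \<le> k \<and> k < y" using less.prems(1)[of i k] by auto
      next
        show "free_chord i j \<or> tight_chord i j" if "Suc x \<le> i" "i < j" "j < y" "M i j" for i j
          using less.prems(3)[of i j] that by simp
      qed (use xy in auto)
      then show ?thesis using word.Single False by blast
    next
      case True
      then obtain j where j: "M x j" by blast
      have "x \<le> j" "j < y" using less.prems(1)[OF _ xy j] by auto
      then have j': "x < j" "j < y" using far[OF j] by auto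
      have "\<exists>ws. word (Suc j) ws y"
      proof (rule less.hyps)
        fix i k assume *: "Suc j \<le> i" "i < y" "M i k"
        then have "x \<le> k \<and> k < y" using less.prems(1)[of i k] j' by auto
        moreover have "\<not> k \<le> j"
        proof
          assume "k \<le> j"
          then have "i \<le> j" using chord_closed(2)[OF j, of k i] sym[OF *(3)] calculation by auto
          then show False using * by simp
        qed
        ultimately show "Suc j \<le> k \<and> k < y" by auto
      next
        show "free_chord i k \<or> tight_chord i k" if "Suc j \<le> i" "i < k" "k < y" "M i k" for i k
          using less.prems(3)[of i k] that j' by simp
      qed (use xy j' in auto)
      then show ?thesis using word.Free[OF j j'(1)] word.Tight[OF j j'(1)] less.prems(3)[OF _ j'(1) j'(2) j] by blast
    qed
  qed
qed

lemma valid_on_swap_to: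
  assumes "valid_on c x y" "c i \<noteq> None"
  obtains d where "valid_on d x y" "d i = Some f" "\<And>k. d k = None \<longleftrightarrow> c k = None"
proof (cases "c i = Some f")
  case True then show ?thesis using that assms by blast
next
  case False
  then have "(map_option Not \<circ> c) i = Some f" using assms by auto
  then show ?thesis using that[of "map_option Not \<circ> c"] assms valid_on_swap by simp
qed

lemma chord_colouring_start:
  assumes "valid_on c i (Suc j)" "M i j" "i < j" "c i \<noteq> None" "c j \<noteq> None"
  obtains d where "valid_on d i (Suc j)" "d i = Some f" "d j = Some (\<not> f)" "\<And>k. d k = None \<longleftrightarrow> c k = None"
proof -
  obtain d where d: "valid_on d i (Suc j)" "d i = Some f" "\<And>k. d k = None \<longleftrightarrow> c k = None"
    using valid_on_swap_to[OF assms(1,4)] by blast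
  have "d i \<noteq> d j" using valid_onD_proper[OF d(1), of i j] assms by (auto simp: adj_def)
  then have "d j = Some (\<not> f)" using d(2) d(3)[of j] assms(5) by auto
  then show ?thesis using that d by blast
qed

text \<open>A single vertex is first and last at once, so it keeps the colour \<open>f\<close>,
  while the two ends of a chord differ: this is the Boolean \<open>f = (s = Single)\<close>. For a
  tight chord nothing is said about exposure, as vertices beyond the chord may have to take
  \<open>None\<close>.\<close>

lemma word_item_colouring:
  assumes "word x [s] (Suc v)"
  obtains d where "valid_on d x (Suc v)" "d x = Some f" "d v = Some (f = (s = Single))" "x \<le> v"
    "s \<noteq> Tight \<Longrightarrow> \<not> exposed d x (Suc v) x \<and> \<not> exposed d x (Suc v) v"
  using assms
proof cases
  case Single
  then have "x = v" by (simp_all add: word_Nil_iff)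
  have irr: "\<not> adj v v" using far[of v v] by (auto simp: adj_def)
  have "{v..<Suc v} = {v}" by auto
  then have valid_on: "valid_on (\<lambda>_. Some f) x (Suc v)"
    unfolding valid_on_def \<open>x = v\<close> using irr by simp
  show ?thesis
    by (rule that[OF valid_on]) (use Single(1) \<open>x = v\<close> in \<open>simp_all add: exposed_def\<close>)
next
  case (Free j)
  then have jv: "j = v" by (simp_all add: word_Nil_iff)
  obtain c where c: "valid_on c x (Suc j)" "c x \<noteq> None" "c j \<noteq> None" "c (Suc x) \<noteq> None" "c (j - 1) \<noteq> None"
    using Free(4) by (auto simp: free_chord_def)
  obtain d where d: "valid_on d x (Suc j)" "d x = Some f" "d j = Some (\<not> f)" "\<And>k. d k = None \<longleftrightarrow> c k = None"
    using chord_colouring_start[OF c(1) Free(2,3) c(2,3)] by blast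
  have "k = Suc x \<or> k = j" if "adj x k" "x \<le> k" for k
    using that uniq[of x k j] Free(2) by (auto simp: adj_def)
  then have ex: "\<not> exposed d x (Suc v) x"
    unfolding exposed_def using d(4) c(3,4) by (metis atLeastLessThan_iff)
  have "k = j - 1 \<or> k = x" if "adj j k" "k \<le> j" for k
    using that uniq[of j k x] sym[OF Free(2)] by (auto simp: adj_def)
  then have "\<not> exposed d x (Suc v) v"
    unfolding exposed_def using d(4) c(2,5) jv by (metis atLeastLessThan_iff less_Suc_eq_le)
  then show ?thesis using that[of d] d ex jv Free(1,3) by simp
next
  case (Tight j)
  then have jv: "j = v" by (simp_all add: word_Nil_iff)
  obtain c where c: "valid_on c x (Suc j)" "c x \<noteq> None" "c j \<noteq> None"
    using Tight(4) by (auto simp: tight_chord_def)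
  obtain d where d: "valid_on d x (Suc j)" "d x = Some f" "d j = Some (\<not> f)"
    using chord_colouring_start[OF c(1) Tight(2,3) c(2,3)] by blast
  then show ?thesis using that[of d] Tight(1,3) jv by simp
qed

text \<open>Colours alternate along the face and chords contribute two vertices each, so the last
  colour depends on the parity of the \<open>Single\<close> items only. A tight first item is
  excluded after \<open>None\<close> at \<open>w\<close>, because \<open>Suc w\<close> might be
  exposed from beyond the chord.\<close>

lemma word_extend_colouring:
  assumes "word (Suc w) ws (Suc v)" "x \<le> w" "valid_on c x (Suc w)" "c w \<noteq> Some f"
    "c w = None \<Longrightarrow> ws = [] \<or> hd ws \<noteq> Tight"
  shows "\<exists>d. valid_on d x (Suc v) \<and> (\<forall>i\<le>w. d i = c i) \<and>
    (ws \<noteq> [] \<longrightarrow> w < v \<and> d (Suc w) = Some f \<and> d v = Some (f = odd (count_list ws Single))) \<and>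
    (ws \<noteq> [] \<and> last ws \<noteq> Tight \<and> c w \<noteq> None \<longrightarrow> \<not> exposed d x (Suc v) v)"
  using assms
proof (induction ws arbitrary: w c f)
  case Nil
  then have "w = v" by (simp_all add: word_Nil_iff)
  then show ?case using Nil by auto
next
  case (Cons s ws)
  have "word (Suc w) ([s] @ ws) (Suc v)" using Cons.prems by simp
  then obtain u' where u': "word (Suc w) [s] u'" "word u' ws (Suc v)" using word_append by blast
  have "Suc w \<le> u'" using u' word_mono by blast
  then obtain u where u: "u' = Suc u" by (cases u') auto
  note w = u'[unfolded u]
  obtain d where d: "valid_on d (Suc w) (Suc u)" "d (Suc w) = Some f" "d u = Some (f = (s = Single))" "Suc w \<le> u"
    "s \<noteq> Tight \<Longrightarrow> \<not> exposed d (Suc w) (Suc u) (Suc w) \<and> \<not> exposed d (Suc w) (Suc u) u"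
    using word_item_colouring[OF w(1)] by blast
  let ?e = "\<lambda>i. if i \<le> w then c i else d i"
  have noM: "\<not> M i j" if "i \<le> w" "w < j" "j < Suc u" for i j
    using word_closed[OF w(1), of j i] sym[of i j] that by auto
  have e: "valid_on ?e x (Suc u)"
  proof (rule valid_on_glue[OF Cons.prems(3) d(1) Cons.prems(2)])
    show "c w = None \<Longrightarrow> \<not> exposed d (Suc w) (Suc u) (Suc w)"
      using Cons.prems d by auto
  qed (use Cons.prems d noM in auto)
  have ex: "\<not> exposed ?e x (Suc u) u" if s: "s \<noteq> Tight" "c w \<noteq> None"
  proof
    assume "exposed ?e x (Suc u) u"
    then obtain j where j: "x \<le> j" "j < Suc u" "adj u j" "?e j = None" by (auto simp: exposed_def)
    show False
    proof (cases "j \<le> w")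
      case False
      then show False using d(5)[OF s(1)] j by (auto simp: exposed_def)
    next
      case True
      then have "j = w" using noM[of j u] sym[of u j] d j by (auto simp: adj_def)
      then show False using j s by simp
    qed
  qed
  \<comment> \<open>The next item has to start with the colour opposite to that of
    \<open>u\<close>.\<close>
  define g where "g \<longleftrightarrow> \<not> (f = (s = Single))"
  obtain d' where d': "valid_on d' x (Suc v)" "\<forall>i\<le>u. d' i = ?e i"
    "ws \<noteq> [] \<longrightarrow> u < v \<and> d' (Suc u) = Some g \<and> d' v = Some (g = odd (count_list ws Single))"
    "ws \<noteq> [] \<and> last ws \<noteq> Tight \<and> ?e u \<noteq> None \<longrightarrow> \<not> exposed d' x (Suc v) v"
    using Cons.IH[OF w(2) _ e, of g] Cons.prems d by (auto simp: g_def)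
  have "w < v" using d(4) word_mono[OF w(2)] by simp
  moreover have "d' v = Some (f = odd (count_list (s # ws) Single))"
  proof (cases "ws = []")
    case True
    then have "u = v" using w(2) by (simp_all add: word_Nil_iff)
    then show ?thesis using True d d' by auto
  next
    case False
    then show ?thesis using d' by (auto simp: g_def)
  qed
  moreover have "\<not> exposed d' x (Suc v) v" if "last (s # ws) \<noteq> Tight" "c w \<noteq> None"
  proof (cases "ws = []")
    case True
    then have "u = v" using w(2) by (simp_all add: word_Nil_iff)
    then have "exposed d' x (Suc v) v = exposed ?e x (Suc u) u"
      using d'(2) by (auto simp: exposed_def less_Suc_eq_le)
    then show ?thesis using True ex that by auto
  next
    case False
    then show ?thesis using that d d' by auto
  qed
  ultimately show ?case using d d' by (intro exI[of _ d']) auto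
qed


lemma chord_free_or_tight:
  "M a b \<Longrightarrow> a < b \<Longrightarrow> free_chord a b \<or> tight_chord a b"
proof (induction "b - a" arbitrary: a b rule: less_induct)
  case less
  have sab: "Suc a < b" using far less.prems by simp
  then obtain v where b: "b = Suc v" "a < v" by (cases b) auto
  \<comment> \<open>The word of the face at \<open>ab\<close>; the chords below \<open>ab\<close>
    are shorter, so the induction hypothesis classifies them.\<close>
  have "\<exists>ws. word (Suc a) ws b"
  proof (rule word_exists)
    fix i k assume i: "Suc a \<le> i" "i < b" "M i k"
    then have "a \<le> k" "k \<le> b" using chord_closed[OF less.prems(1), of i k] by auto
    moreover have "k \<noteq> a" "k \<noteq> b"
      using uniq[OF less.prems(1), of i] uniq[OF sym[OF less.prems(1)], of i] sym[OF i(3)] i by auto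
    ultimately show "Suc a \<le> k \<and> k < b" by simp
  next
    fix i j assume "Suc a \<le> i" "i < j" "j < b" "M i j"
    then show "free_chord i j \<or> tight_chord i j" using less.hyps[of j i] by simp
  qed (use sab in simp)
  then obtain ws where ws: "word (Suc a) ws (Suc v)" using b by blast
  have ne: "ws \<noteq> []" using ws b(2) by (auto simp: word_Nil_iff)
  have irr: "\<not> adj i i" for i using far[of i i] by (auto simp: adj_def)
  have range1: "{x..<Suc x} = {x}" for x :: nat by auto
  have valid1: "valid_on (\<lambda>_. h) x (Suc x)" "\<not> exposed (\<lambda>_. h) x (Suc x) x" for h x
    unfolding valid_on_def exposed_def range1 using irr by simp_all
  have nM: "\<not> M i j" if "word (Suc w) us y" "i \<le> w" "w < j" "j < y" for w us y i j
    using word_closed[OF that(1), of j i] sym[of i j] that by auto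
  \<comment> \<open>An alternating colouring of the face from \<open>a\<close> up to
    \<open>w\<close>, for the part before the vertex that will get \<open>None\<close>.\<close>
  have start: "\<exists>c. valid_on c a (Suc w) \<and> c a = Some h \<and> c w \<noteq> None \<and> (us = [] \<and> w = a \<or> us \<noteq> [] \<and> a < w \<and> c (Suc a) \<noteq> None) \<and>
      (us = [] \<or> last us \<noteq> Tight \<longrightarrow> \<not> exposed c a (Suc w) w)"
    if us: "word (Suc a) us (Suc w)" for us w h
  proof (cases "us = []")
    case True
    then have "w = a" using us by (simp add: word_Nil_iff)
    then show ?thesis using True valid1[of "Some h" a] by (intro exI[of _ "\<lambda>_. Some h"]) simp
  next
    case False
    obtain d where "valid_on d a (Suc w)" "\<forall>i\<le>a. d i = Some h" "a < w" "d (Suc a) = Some (\<not> h)"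
      "d w = Some ((\<not> h) = odd (count_list us Single))" "last us \<noteq> Tight \<longrightarrow> \<not> exposed d a (Suc w) w"
      using word_extend_colouring[OF us order_refl valid1(1)[of "Some h"], of "\<not> h"] False by auto
    then show ?thesis using False by (intro exI[of _ d]) simp
  qed
  \<comment> \<open>If \<open>a\<close> and \<open>v\<close> have the same Boolean colour,
    \<open>b\<close> takes the other one. Then none of \<open>a\<close>, \<open>Suc a\<close>,
    \<open>v\<close>, \<open>b\<close> has colour \<open>None\<close>.\<close>
  have closeP: "free_chord a b"
    if c: "valid_on c a (Suc v)" "c a = Some e" "c (Suc a) \<noteq> None" "c v = Some e" for c e
  proof -
    have "valid_on (c(b := Some (\<not> e))) a (Suc b)"
      by (rule valid_on_close[OF c(1)[folded b(1)] less.prems(1) sab b(1)]) (use c in auto)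
    then show ?thesis unfolding free_chord_def
      by (rule exI[of _ "c(b := Some (\<not> e))", OF conjI]) (use c sab b in auto)
  qed
  show ?case
  \<comment> \<open>Each chord of the word puts two vertices on the face, and so does
    \<open>ab\<close>; hence the face has the parity of the number of \<open>Single\<close>
    items.\<close>
  proof (cases "even (count_list ws Single)")
    case True
    obtain d where "valid_on d a (Suc v)" "d a = Some True" "d (Suc a) = Some False" "d v = Some True"
      using word_extend_colouring[OF ws order_refl valid1(1)[of "Some True"], of False] ne True by auto
    then show ?thesis using closeP[of d True] by simp
  next
    case odd: False
    then have Single: "Single \<in> set ws" using count_notin[of Single ws] by fastforce
    show ?thesis
    proof (cases "Tight \<in> set ws")
      case True
      have "(\<exists>us vs. ws = us @ Tight # vs \<and> vs \<noteq> [] \<and> hd vs \<noteq> Tight) \<or>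
          (\<exists>us vs. ws = us @ Tight # vs \<and> us \<noteq> [] \<and> last us \<noteq> Tight)"
        using list_boundary[OF True Single] by simp
      then obtain us vs where *: "ws = us @ Tight # vs" "vs \<noteq> [] \<and> hd vs \<noteq> Tight \<or> us \<noteq> [] \<and> last us \<noteq> Tight"
        by blast
      obtain y where y: "word (Suc a) us y" "word y (Tight # vs) (Suc v)" using ws * word_append by blast
      obtain w where w: "y = Suc w" "a \<le> w" using word_mono[OF y(1)] by (cases y) auto
      obtain u where u: "M (Suc w) u" "Suc w < u" "tight_chord (Suc w) u" "word (Suc u) vs (Suc v)"
        using y(2)[unfolded w] by cases auto
      have uv: "u \<le> v" using word_mono[OF u(4)] by simp
      obtain c where c: "valid_on c a (Suc w)" "c a = Some True" "c w \<noteq> None"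
          "us = [] \<and> w = a \<or> us \<noteq> [] \<and> a < w \<and> c (Suc a) \<noteq> None"
          "us = [] \<or> last us \<noteq> Tight \<longrightarrow> \<not> exposed c a (Suc w) w"
        using start[OF y(1)[unfolded w], of True] by blast
      have nMw: "\<not> M i j" if "i \<le> w" "w < j" "j < Suc u" for i j
        using nM[OF y(2)[unfolded w(1)], of i j] that uv by simp
      from *(2) have "free_chord a b"
      proof
        \<comment> \<open>The right end \<open>u\<close> of the tight chord gets
          \<open>None\<close>. Its successor on the face is not on a tight chord, so it is not
          exposed from beyond.\<close>
        assume vs: "vs \<noteq> [] \<and> hd vs \<noteq> Tight"
        obtain d0 where d0: "valid_on d0 (Suc w) (Suc u)" "d0 (Suc w) \<noteq> None" "d0 u = None"
          using u(3) by (auto simp: tight_chord_def)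
        obtain d where d: "valid_on d (Suc w) (Suc u)" "d (Suc w) = Some (\<not> the (c w))" "d u = None"
          using valid_on_swap_to[OF d0(1,2), of "\<not> the (c w)"] d0(3) by metis
        let ?e = "\<lambda>i. if i \<le> w then c i else d i"
        have e: "valid_on ?e a (Suc u)"
          by (rule valid_on_glue[OF c(1) d(1) w(2)]) (use u c d nMw in auto)
        have "?e u = None" using u d by simp
        \<comment> \<open>After \<open>None\<close> at \<open>u\<close> the alternation may restart
          with either Boolean; this one makes \<open>v\<close> agree with \<open>a\<close>.\<close>
        then obtain c' where c': "valid_on c' a (Suc v)" "\<forall>i\<le>u. c' i = ?e i" "c' v = Some True"
          using word_extend_colouring[OF u(4) _ e, of "odd (count_list vs Single)"] vs w u(2) by auto
        have "c' (Suc a) \<noteq> None" using c'(2) c(4) u(2) d(2) w(2) by (auto simp: Suc_le_eq)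
        moreover have "c' a = Some True" using c'(2) c(2) u(2) w(2) by auto
        ultimately show ?thesis using closeP[OF c'(1)] c'(3) by simp
      next
        assume us: "us \<noteq> [] \<and> last us \<noteq> Tight"
        \<comment> \<open>Now the left end gets \<open>None\<close>, and the Boolean of
          \<open>u\<close> is free. The part \<open>vs\<close> starts with the opposite of
          \<open>?g\<close>, and this choice gives \<open>v\<close> the colour \<open>True\<close>,
          also when \<open>vs\<close> is empty and \<open>v = u\<close>.\<close>
        let ?g = "even (count_list vs Single)"
        obtain d0 where d0: "valid_on d0 (Suc w) (Suc u)" "d0 (Suc w) = None" "d0 u \<noteq> None"
          using u(3) by (auto simp: tight_chord_def)
        obtain d where d: "valid_on d (Suc w) (Suc u)" "d u = Some ?g" "d (Suc w) = None"
          using valid_on_swap_to[OF d0(1,3), of ?g] d0(2) by metis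
        let ?e = "\<lambda>i. if i \<le> w then c i else d i"
        have e: "valid_on ?e a (Suc u)"
          by (rule valid_on_glue[OF c(1) d(1) w(2)]) (use u c d us nMw in auto)
        have eu: "?e u = Some ?g" using u d by simp
        then obtain c' where c': "valid_on c' a (Suc v)" "\<forall>i\<le>u. c' i = ?e i"
            "vs \<noteq> [] \<longrightarrow> c' v = Some ((\<not> ?g) = odd (count_list vs Single))"
          using word_extend_colouring[OF u(4) _ e, of "\<not> ?g"] w u(2) by auto
        have "c' v = Some True"
        proof (cases "vs = []")
          case True
          then have "u = v" using u(4) by (simp add: word_Nil_iff)
          moreover have "c' u = Some True" using c'(2) eu True by simp
          ultimately show ?thesis by simp
        qed (use c'(3) in simp)
        moreover have "c' (Suc a) \<noteq> None" using c'(2) c(4) u(2) us w(2) by (auto simp: Suc_le_eq)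
        moreover have "c' a = Some True" using c'(2) c(2) u(2) w(2) by auto
        ultimately show ?thesis using closeP[OF c'(1)] by simp
      qed
      then show ?thesis ..
    next
      case False
      have hl: "hd ws \<noteq> Tight" "last ws \<noteq> Tight" using False ne hd_in_set last_in_set by metis+
      \<comment> \<open>With \<open>None\<close> at \<open>a\<close>, the alternation from
        \<open>Suc a\<close> to \<open>v\<close> starts and ends in the same colour by oddness, and
        \<open>b\<close> gets the other Boolean.\<close>
      have "\<exists>c. valid_on c a (Suc b) \<and> c a = None \<and> c b \<noteq> None"
      proof -
        obtain d where d: "valid_on d a (Suc v)" "\<forall>i\<le>a. d i = None" "d v = Some True"
          using word_extend_colouring[OF ws order_refl valid1(1)[of None], of True] ne hl odd by auto
        have "valid_on (d(b := Some False)) a (Suc b)"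
          by (rule valid_on_close[OF d(1)[folded b(1)] less.prems(1) sab b(1)]) (use d in auto)
        then show ?thesis
          by (rule exI[of _ "d(b := Some False)", OF conjI]) (use d b in auto)
      qed
      moreover have "\<exists>c. valid_on c a (Suc b) \<and> c a \<noteq> None \<and> c b = None"
      proof -
        obtain d where d: "valid_on d a (Suc v)" "\<forall>i\<le>a. d i = Some True" "d (Suc a) = Some False"
            "d v = Some False" "\<not> exposed d a (Suc v) v"
          using word_extend_colouring[OF ws order_refl valid1(1)[of "Some True"], of False] ne hl odd by auto
        \<comment> \<open>The only chord at \<open>a\<close> is \<open>ab\<close>, so before
          \<open>b\<close> is coloured only \<open>Suc a\<close> could expose
          \<open>a\<close>.\<close>
        have "j = Suc a" if "adj a j" "a \<le> j" "j < b" for j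
          using that uniq[OF less.prems(1), of j] by (auto simp: adj_def)
        then have "\<not> exposed d a b a" unfolding exposed_def using d(3)
          by (metis atLeastLessThan_iff option.distinct(1))
        then have "valid_on (d(b := None)) a (Suc b)"
          by (intro valid_on_close[OF d(1)[folded b(1)] less.prems(1) sab b(1)]) (use d b in auto)
        then show ?thesis
          by (rule exI[of _ "d(b := None)", OF conjI]) (use d b in auto)
      qed
      moreover have "\<exists>c. valid_on c a (Suc b) \<and> c a \<noteq> None \<and> c b \<noteq> None"
      proof -
        \<comment> \<open>Here a \<open>Single\<close> vertex \<open>Suc w\<close> takes
          \<open>None\<close>. As no item is tight, its neighbours on the face are not exposed from
          beyond.\<close>
        obtain us vs where *: "ws = us @ Single # vs" using split_list[OF Single] by blast
        obtain y where y: "word (Suc a) us y" "word y (Single # vs) (Suc v)" using ws * word_append by blast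
        obtain w where w: "y = Suc w" "a \<le> w" using word_mono[OF y(1)] by (cases y) auto
        have u: "word (Suc (Suc w)) vs (Suc v)"
          using y(2)[unfolded w] by cases auto
        have uv: "Suc w \<le> v" using word_mono[OF u] by simp
        have "us = [] \<or> last us \<noteq> Tight" using False * last_in_set[of us] by fastforce
        then obtain c where c: "valid_on c a (Suc w)" "c a = Some True" "c w \<noteq> None" "\<not> exposed c a (Suc w) w"
          using start[OF y(1)[unfolded w], of True] by blast
        have nMw: "\<not> M i j" if "i \<le> w" "w < j" "j < Suc (Suc w)" for i j
          using nM[OF y(2)[unfolded w(1)], of i j] that uv by simp
        let ?e = "\<lambda>i. if i \<le> w then c i else None"
        have e: "valid_on ?e a (Suc (Suc w))"
          by (rule valid_on_glue[OF c(1) valid1(1) w(2)]) (use c nMw in auto)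
        have "vs = [] \<or> hd vs \<noteq> Tight" using False * hd_in_set[of vs] by fastforce
        then obtain c' where c': "valid_on c' a (Suc v)" "\<forall>i\<le>Suc w. c' i = ?e i" "vs \<noteq> [] \<longrightarrow> c' v = Some True"
          using word_extend_colouring[OF u _ e, of "odd (count_list vs Single)"] w by auto
        \<comment> \<open>If \<open>vs\<close> is empty, \<open>v\<close> is itself the vertex
          coloured \<open>None\<close>; otherwise it has colour \<open>True\<close>. Either way
          \<open>False\<close> is available at \<open>b\<close>.\<close>
        have "c' v \<noteq> Some False"
        proof (cases "vs = []")
          case True
          then have "v = Suc w" using u by (simp add: word_Nil_iff)
          then show ?thesis using c'(2) by simp
        qed (use c'(3) in simp)
        moreover have "c' a = Some True" using c'(2) c(2) w(2) by auto
        ultimately have "valid_on (c'(b := Some False)) a (Suc b)"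
          by (intro valid_on_close[OF c'(1)[folded b(1)] less.prems(1) sab b(1)]) auto
        then show ?thesis
          by (rule exI[of _ "c'(b := Some False)", OF conjI]) (use \<open>c' a = Some True\<close> b in auto)
      qed
      ultimately show ?thesis by (simp add: tight_chord_def)
    qed
  qed
qed

end

section \<open>Theta curves and crossing arcs\<close>

text \<open>The first arc followed by the reversed second one is a simple closed curve, so these are
  the conclusions of the Jordan curve theorem, stated for two arcs.\<close>

lemma arc_pair_circle:
  fixes c1 c2 :: "real \<Rightarrow> complex"
  assumes "arc c1" "arc c2" "pathstart c1 = a" "pathfinish c1 = b" "pathstart c2 = a" "pathfinish c2 = b"
    and "path_image c1 \<inter> path_image c2 = {a, b}"
  defines "C \<equiv> path_image c1 \<union> path_image c2"
  shows "open (inside C)" "Topological_Spaces.connected (inside C)" "inside C \<noteq> {}" "open (outside C)" "Topological_Spaces.connected (outside C)"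
    "frontier (inside C) = C" "inside C \<inter> outside C = {}" "inside C \<union> outside C = - C" "compact C"
proof -
  have s: "simple_path (c1 +++ reversepath c2)"
    by (rule simple_path_join_loop) (use assms in \<open>auto simp: arc_reversepath\<close>)
  have f: "pathfinish (c1 +++ reversepath c2) = pathstart (c1 +++ reversepath c2)"
    using assms by simp
  have i: "path_image (c1 +++ reversepath c2) = C"
    using assms by (simp add: path_image_join)
  show "open (inside C)" "Topological_Spaces.connected (inside C)" "inside C \<noteq> {}" "open (outside C)" "Topological_Spaces.connected (outside C)"
    "frontier (inside C) = C" "inside C \<inter> outside C = {}" "inside C \<union> outside C = - C"
    using Jordan_inside_outside[OF s f] unfolding i by auto
  show "compact C" unfolding C_def using assms by (auto simp: compact_Un compact_arc_image)
qed

lemma connected_disjoint_circle: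
  fixes c1 c2 :: "real \<Rightarrow> complex"
  assumes "arc c1" "arc c2" "pathstart c1 = a" "pathfinish c1 = b" "pathstart c2 = a" "pathfinish c2 = b"
    and "path_image c1 \<inter> path_image c2 = {a, b}"
    and "Topological_Spaces.connected T" "T \<inter> (path_image c1 \<union> path_image c2) = {}"
  shows "T \<subseteq> inside (path_image c1 \<union> path_image c2) \<or> T \<subseteq> outside (path_image c1 \<union> path_image c2)"
proof -
  let ?C = "path_image c1 \<union> path_image c2"
  note J = arc_pair_circle[OF assms(1-7)]
  have "T \<subseteq> inside ?C \<union> outside ?C" unfolding J(8) using assms(9) by (rule disjoint_eq_subset_Compl[THEN iffD1])
  moreover have "inside ?C \<inter> outside ?C \<inter> T = {}" unfolding J(7) by (rule Int_empty_left)
  ultimately have "inside ?C \<inter> T = {} \<or> outside ?C \<inter> T = {}"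
    using connectedD[OF assms(8) J(1) J(4)] by metis
  then show ?thesis using \<open>T \<subseteq> inside ?C \<union> outside ?C\<close> by blast
qed

text \<open>The inside of the circle \<open>c1\<close>, \<open>c3\<close> is connected and avoids
  \<open>c1\<close> and \<open>c2\<close>. As it meets the inside of the circle \<open>c1\<close>,
  \<open>c2\<close>, it lies in it. Passing to closures takes \<open>c3\<close> along.\<close>

lemma theta_absorb:
  fixes c1 c2 c3 :: "real \<Rightarrow> complex"
  assumes c1: "arc c1" "pathstart c1 = a" "pathfinish c1 = b"
    and c2: "arc c2" "pathstart c2 = a" "pathfinish c2 = b"
    and c3: "arc c3" "pathstart c3 = a" "pathfinish c3 = b"
    and i12: "path_image c1 \<inter> path_image c2 = {a, b}"
    and i13: "path_image c1 \<inter> path_image c3 = {a, b}"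
    and i23: "path_image c2 \<inter> path_image c3 = {a, b}"
    and out: "path_image c2 \<inter> inside (path_image c1 \<union> path_image c3) = {}"
    and meet: "inside (path_image c1 \<union> path_image c3) \<inter> inside (path_image c1 \<union> path_image c2) \<noteq> {}"
  shows "path_image c3 - {a, b} \<subseteq> inside (path_image c1 \<union> path_image c2)"
proof -
  let ?I2 = "inside (path_image c1 \<union> path_image c2)" and ?I3 = "inside (path_image c1 \<union> path_image c3)"
  note J2 = arc_pair_circle[OF c1(1) c2(1) c1(2,3) c2(2,3) i12]
  note J3 = arc_pair_circle[OF c1(1) c3(1) c1(2,3) c3(2,3) i13]
  have "?I3 \<inter> (path_image c1 \<union> path_image c2) = {}" using J3 out by blast
  then have "?I3 \<subseteq> ?I2"
    using connected_disjoint_circle[OF c1(1) c2(1) c1(2,3) c2(2,3) i12 J3(2)] meet J2(7) by blast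
  then have "closure ?I3 \<subseteq> closure ?I2" by (rule closure_mono)
  moreover have "path_image c3 \<subseteq> closure ?I3" using J3(6) by (auto simp: frontier_def)
  moreover have "closure ?I2 \<subseteq> ?I2 \<union> (path_image c1 \<union> path_image c2)"
    using J2(6) closure_Un_frontier[of ?I2] by blast
  ultimately show ?thesis using i13 i23 by blast
qed

text \<open>Otherwise \<open>c2\<close> runs outside the circle \<open>c1\<close>,
  \<open>c3\<close>. A point \<open>z\<close> inside that circle must lie inside one of the other
  two circles, and \<open>theta_absorb\<close> then puts \<open>c3\<close> or \<open>c1\<close>
  inside it, a contradiction.\<close>

lemma theta_inside:
  fixes c1 c2 c3 :: "real \<Rightarrow> complex"
  assumes c1: "arc c1" "pathstart c1 = a" "pathfinish c1 = b"
    and c2: "arc c2" "pathstart c2 = a" "pathfinish c2 = b"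
    and c3: "arc c3" "pathstart c3 = a" "pathfinish c3 = b"
    and i12: "path_image c1 \<inter> path_image c2 = {a, b}"
    and i13: "path_image c1 \<inter> path_image c3 = {a, b}"
    and i23: "path_image c2 \<inter> path_image c3 = {a, b}"
  shows "path_image c3 - {a, b} \<subseteq> inside (path_image c1 \<union> path_image c2) \<or>
    path_image c2 - {a, b} \<subseteq> inside (path_image c1 \<union> path_image c3) \<or>
    path_image c1 - {a, b} \<subseteq> inside (path_image c2 \<union> path_image c3)"
proof (rule ccontr)
  assume neg: "\<not> ?thesis"
  have i21: "path_image c2 \<inter> path_image c1 = {a, b}" and i31: "path_image c3 \<inter> path_image c1 = {a, b}"
    and i32: "path_image c3 \<inter> path_image c2 = {a, b}" using i12 i13 i23 by auto
  let ?I2 = "inside (path_image c1 \<union> path_image c2)" and ?I3 = "inside (path_image c1 \<union> path_image c3)"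
    and ?I23 = "inside (path_image c2 \<union> path_image c3)"
  let ?O2 = "outside (path_image c1 \<union> path_image c2)" and ?O3 = "outside (path_image c1 \<union> path_image c3)"
    and ?O23 = "outside (path_image c2 \<union> path_image c3)"
  note J2 = arc_pair_circle[OF c1(1) c2(1) c1(2,3) c2(2,3) i12]
  note J3 = arc_pair_circle[OF c1(1) c3(1) c1(2,3) c3(2,3) i13]
  note J23 = arc_pair_circle[OF c2(1) c3(1) c2(2,3) c3(2,3) i23]
  have "Topological_Spaces.connected (path_image c2 - {a, b})"
    using connected_simple_path_endless[of c2] c2 arc_imp_simple_path by auto
  moreover have "(path_image c2 - {a, b}) \<inter> (path_image c1 \<union> path_image c3) = {}" using i12 i23 by blast
  ultimately have "path_image c2 - {a, b} \<subseteq> ?O3"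
    using connected_disjoint_circle[OF c1(1) c3(1) c1(2,3) c3(2,3) i13] neg by blast
  then have out: "path_image c2 \<inter> ?I3 = {}" using J3(7,8) i13 by blast
  obtain z where z: "z \<in> ?I3" using J3(3) by blast
  have "bounded (path_image c1 \<union> path_image c2 \<union> path_image c3)"
    using J2(9) J3(9) compact_imp_bounded by (metis bounded_Un)
  \<comment> \<open>The point \<open>y\<close> plays the role of infinity: it is outside each of the
    three circles.\<close>
  then obtain y where y: "y \<in> outside (path_image c1 \<union> path_image c2 \<union> path_image c3)"
    using outside_bounded_nonempty by blast
  have sub: "outside (path_image c1 \<union> path_image c2 \<union> path_image c3) \<subseteq> ?O2 \<inter> ?O3 \<inter> ?O23"
    by (intro Int_greatest outside_mono) auto
  \<comment> \<open>Otherwise Janiszewski's theorem joins \<open>z\<close> to infinity, as the two circles share the connected set \<open>c2\<close>.\<close>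
  have "z \<in> ?I2 \<or> z \<in> ?I23"
  proof (rule ccontr)
    assume "\<not> ?thesis"
    then have zO: "z \<in> ?O2" "z \<in> ?O23" using z out J2(8) J23(8) J3(8) by blast+
    have "?O2 \<subseteq> - (path_image c1 \<union> path_image c2)" "?O23 \<subseteq> - (path_image c2 \<union> path_image c3)"
      using J2(8) J23(8) by blast+
    then have cc: "connected_component (- (path_image c1 \<union> path_image c2)) z y"
      "connected_component (- (path_image c2 \<union> path_image c3)) z y"
      using zO y sub J2(5) J23(5) unfolding connected_component_def by blast+
    have "(path_image c1 \<union> path_image c2) \<inter> (path_image c2 \<union> path_image c3) = path_image c2"
      using i13 i12 by blast
    then have "Topological_Spaces.connected ((path_image c1 \<union> path_image c2) \<inter> (path_image c2 \<union> path_image c3))"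
      using c2(1) by (simp add: connected_arc_image)
    from Janiszewski[OF J2(9) compact_imp_closed[OF J23(9)] this cc]
    have "connected_component (- (path_image c1 \<union> path_image c3)) z y"
      by (rule connected_component_of_subset) blast
    then have "z \<in> ?O3" using y sub outside_same_component connected_component_sym by blast
    then show False using z J3(7) by blast
  qed
  then show False
  proof
    assume "z \<in> ?I2"
    then show False using theta_absorb[OF c1 c2 c3 i12 i13 i23 out] z neg by blast
  next
    assume "z \<in> ?I23"
    then show False using theta_absorb[OF c3 c2 c1 i32 i31 i21] out z neg by (simp add: Un_commute) blast
  qed
qed

text \<open>The inside of \<open>C\<close> is open and disjoint from the outside of the larger set
  \<open>D\<close>, hence also from its closure. This is how outerplanarity is used: no vertex lies
  inside a circle of the drawing.\<close>

lemma inside_not_frontier_outside: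
  fixes C :: "complex set"
  assumes "C \<subseteq> D" "closed C"
  shows "inside C \<inter> frontier (outside D) = {}"
proof -
  have "inside C \<inter> outside D = {}" using outside_mono[OF assms(1)] inside_Int_outside[of C] by blast
  then have "inside C \<inter> closure (outside D) = {}"
    using open_Int_closure_eq_empty[OF open_inside[OF assms(2)]] by blast
  then show ?thesis by (auto simp: frontier_def)
qed

text \<open>The arc \<open>e\<close> splits the disc into two regions. The interior of
  \<open>f\<close> is connected and avoids \<open>e\<close>, so it stays in one region, and both
  ends of \<open>f\<close> lie in the closure of that region. But \<open>x\<close> is not in the
  closure on the side of \<open>c2\<close>, nor \<open>y\<close> in the one on the side of
  \<open>c1\<close>.\<close>

lemma crossing_arcs:
  fixes c1 c2 e :: "real \<Rightarrow> complex"
  assumes c1: "arc c1" "pathstart c1 = a" "pathfinish c1 = b"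
    and c2: "arc c2" "pathstart c2 = a" "pathfinish c2 = b"
    and e: "arc e" "pathstart e = a" "pathfinish e = b"
    and i12: "path_image c1 \<inter> path_image c2 = {a, b}"
    and i1: "path_image c1 \<inter> path_image e = {a, b}"
    and i2: "path_image c2 \<inter> path_image e = {a, b}"
    and ein: "path_image e - {a, b} \<subseteq> inside (path_image c1 \<union> path_image c2)"
    and f: "arc f" "pathstart f = x" "pathfinish f = y"
    and fin: "path_image f - {x, y} \<subseteq> inside (path_image c1 \<union> path_image c2)"
    and fe: "path_image f \<inter> path_image e = {}"
    and x: "x \<in> path_image c1" and y: "y \<in> path_image c2"
  shows False
proof -
  have ab: "a \<noteq> b" using c1 arc_distinct_ends by blast
  have xy: "x \<noteq> y" using f arc_distinct_ends by blast
  have "path_image e - {a, b} \<noteq> {}"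
    using nonempty_simple_path_endless[of e] arc_imp_simple_path e by auto
  then have "path_image e \<inter> inside (path_image c1 \<union> path_image c2) \<noteq> {}" using ein by blast
  then have split: "inside (path_image c1 \<union> path_image e) \<union> inside (path_image c2 \<union> path_image e) \<union>
           (path_image e - {a,b}) = inside (path_image c1 \<union> path_image c2)"
    using split_inside_simple_closed_curve[of c1 a b c2 e] arc_imp_simple_path c1 c2 e ab i12 i1 i2 by metis
  note J1 = arc_pair_circle[OF c1(1) e(1) c1(2,3) e(2,3) i1]
  note J2 = arc_pair_circle[OF c2(1) e(1) c2(2,3) e(2,3) i2]
  have con: "Topological_Spaces.connected (path_image f - {x, y})"
    using connected_simple_path_endless[of f] f arc_imp_simple_path by auto
  have ne: "path_image f - {x, y} \<noteq> {}"
    using nonempty_simple_path_endless[of f] arc_imp_simple_path f by auto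
  \<comment> \<open>The ends of \<open>f\<close> are limits of its interior points.\<close>
  have "path_image f \<subseteq> closure (path_image f - {x, y})"
  proof -
    have "f ` {0<..<1} = path_image f - {x, y}"
      using simple_path_endless[of f] f arc_imp_simple_path by auto
    moreover have "f ` closure {0<..<1} \<subseteq> closure (f ` {0<..<1})"
      by (rule image_closure_subset[OF _ closed_closure closure_subset])
        (use f in \<open>simp add: arc_def path_def\<close>)
    ultimately show ?thesis by (simp add: path_image_def)
  qed
  moreover have "path_image f - {x, y} \<subseteq> inside (path_image c1 \<union> path_image e) \<or>
      path_image f - {x, y} \<subseteq> inside (path_image c2 \<union> path_image e)"
  proof -
    have "(path_image f - {x, y}) \<inter> (path_image c1 \<union> path_image e) = {}"
      using fe fin inside_no_overlap[of "path_image c1 \<union> path_image c2"] by blast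
    from connected_disjoint_circle[OF c1(1) e(1) c1(2,3) e(2,3) i1 con this]
    show ?thesis using split fin fe J1(7) by blast
  qed
  ultimately have "path_image f \<subseteq> closure (inside (path_image c1 \<union> path_image e)) \<or>
    path_image f \<subseteq> closure (inside (path_image c2 \<union> path_image e))"
    by (meson closure_mono order_trans)
  then have or: "y \<in> closure (inside (path_image c1 \<union> path_image e)) \<or> x \<in> closure (inside (path_image c2 \<union> path_image e))"
    using f pathstart_in_path_image pathfinish_in_path_image by blast
  have cl1: "closure (inside (path_image c1 \<union> path_image e)) = inside (path_image c1 \<union> path_image e) \<union> (path_image c1 \<union> path_image e)"
    using closure_Un_frontier[of "inside (path_image c1 \<union> path_image e)"] unfolding J1(6) .
  have cl2: "closure (inside (path_image c2 \<union> path_image e)) = inside (path_image c2 \<union> path_image e) \<union> (path_image c2 \<union> path_image e)"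
    using closure_Un_frontier[of "inside (path_image c2 \<union> path_image e)"] unfolding J2(6) .
  have "x \<notin> inside (path_image c1 \<union> path_image c2)" "y \<notin> inside (path_image c1 \<union> path_image c2)"
    using x y inside_no_overlap[of "path_image c1 \<union> path_image c2"] by blast+
  then have "x \<notin> inside (path_image c2 \<union> path_image e)" "y \<notin> inside (path_image c1 \<union> path_image e)"
    unfolding split[symmetric] by simp_all
  moreover have "x \<notin> path_image e" "y \<notin> path_image e"
    using f fe pathstart_in_path_image pathfinish_in_path_image by blast+
  moreover have "x \<notin> path_image c2" "y \<notin> path_image c1"
    using x y i12 i1 \<open>x \<notin> path_image e\<close> \<open>y \<notin> path_image e\<close> by blast+
  ultimately show False using or unfolding cl1 cl2 by simp
qed

section \<open>Paths as vertex lists, and their drawings\<close>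

fun list_edges :: "'a list \<Rightarrow> 'a set set" where
  "list_edges (x # y # zs) = insert {x, y} (list_edges (y # zs))"
| "list_edges _ = {}"

lemma list_edges_subset: "e \<in> list_edges xs \<Longrightarrow> e \<subseteq> set xs"
  by (induction xs rule: list_edges.induct) auto

lemma list_edges_append: "list_edges (us @ v # vs) = list_edges (us @ [v]) \<union> list_edges (v # vs)"
proof (induction us)
  case (Cons u us)
  then show ?case by (cases us) auto
qed simp

lemma list_edges_rev: "list_edges (rev xs) = list_edges xs"
proof (induction xs rule: list_edges.induct)
  case (1 x y zs)
  have "list_edges (rev (x # y # zs)) = list_edges (rev zs @ y # [x])" by simp
  also have "\<dots> = list_edges (rev (y # zs)) \<union> {{x, y}}"
    by (subst list_edges_append) (auto simp: insert_commute)
  finally show ?case using 1 by simp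
qed auto

lemma list_edges_ends:
  assumes "distinct (a # xs @ [b])" "xs \<noteq> []"
  shows "{a, b} \<notin> list_edges (a # xs @ [b])"
proof (cases xs)
  case (Cons x ys)
  then show ?thesis using assms list_edges_subset[of "{a, b}" "x # ys @ [b]"]
    by (auto simp: doubleton_eq_iff)
qed (use assms in simp)

lemma list_edges_ne: "length xs \<ge> 2 \<Longrightarrow> v \<in> set xs \<Longrightarrow> \<exists>e\<in>list_edges xs. v \<in> e"
proof (induction xs rule: list_edges.induct)
  case (1 x y zs)
  then show ?case by (cases zs) auto
qed auto

text \<open>The set \<open>D\<close> is the whole drawing in the application; here it only has to
  contain the drawn edges and to have every vertex on the boundary of its outer face.\<close>

locale outerplane_drawing =
  fixes V :: "'a set" and E :: "'a \<Rightarrow> 'a \<Rightarrow> bool" and p :: "'a \<Rightarrow> complex" and \<gamma> :: "'a set \<Rightarrow> real \<Rightarrow> complex"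
    and D :: "complex set"
  assumes E_sym: "E x y \<Longrightarrow> E y x"
    and E_irrefl: "\<not> E x x"
    and E_V: "E x y \<Longrightarrow> x \<in> V"
    and p_inj: "inj_on p V"
    and edge_arc: "E x y \<Longrightarrow> arc (\<gamma> {x, y})"
    and edge_ends: "E x y \<Longrightarrow> {pathstart (\<gamma> {x, y}), pathfinish (\<gamma> {x, y})} = {p x, p y}"
    and edge_Int: "E x y \<Longrightarrow> E u v \<Longrightarrow> {x, y} \<noteq> {u, v} \<Longrightarrow>
      path_image (\<gamma> {x, y}) \<inter> path_image (\<gamma> {u, v}) \<subseteq> p ` ({x, y} \<inter> {u, v})"
    and edge_D: "E x y \<Longrightarrow> path_image (\<gamma> {x, y}) \<subseteq> D"
    and vert_D: "x \<in> V \<Longrightarrow> p x \<in> frontier (outside D)"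
begin

definition draw :: "'a list \<Rightarrow> complex set" where
  "draw xs = (\<Union>e\<in>list_edges xs. path_image (\<gamma> e))"

lemma list_edgesE:
  assumes "e \<in> list_edges xs" "successively E xs"
  obtains x y where "e = {x, y}" "E x y"
  using assms by (induction xs rule: list_edges.induct) auto

lemma draw_D: "successively E xs \<Longrightarrow> draw xs \<subseteq> D"
  unfolding draw_def using edge_D by (blast elim: list_edgesE)

lemma vert_draw:
  assumes "successively E xs" "length xs \<ge> 2" "v \<in> set xs"
  shows "p v \<in> draw xs"
proof -
  obtain e where e: "e \<in> list_edges xs" "v \<in> e" using list_edges_ne[OF assms(2,3)] by blast
  then obtain x y where xy: "e = {x, y}" "E x y" using list_edgesE assms(1) by metis
  have "p v \<in> {pathstart (\<gamma> e), pathfinish (\<gamma> e)}" using edge_ends[OF xy(2)] xy e by auto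
  then have "p v \<in> path_image (\<gamma> e)" by (auto simp: pathstart_in_path_image pathfinish_in_path_image)
  then show ?thesis using e by (auto simp: draw_def)
qed

lemma draw_Int:
  assumes "successively E xs" "successively E ys" "list_edges xs \<inter> list_edges ys = {}"
  shows "draw xs \<inter> draw ys \<subseteq> p ` (set xs \<inter> set ys)"
proof
  fix z assume "z \<in> draw xs \<inter> draw ys"
  then obtain e f where e: "e \<in> list_edges xs" "z \<in> path_image (\<gamma> e)"
    and f: "f \<in> list_edges ys" "z \<in> path_image (\<gamma> f)" by (auto simp: draw_def)
  obtain x y where xy: "e = {x, y}" "E x y" using list_edgesE[OF e(1) assms(1)] by metis
  obtain u v where uv: "f = {u, v}" "E u v" using list_edgesE[OF f(1) assms(2)] by metis
  have "e \<noteq> f" using e f assms by auto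
  then have "z \<in> p ` (e \<inter> f)" using edge_Int[OF xy(2) uv(2)] e f xy uv by auto
  then show "z \<in> p ` (set xs \<inter> set ys)" using list_edges_subset[OF e(1)] list_edges_subset[OF f(1)] by blast
qed

lemma draw_arc:
  assumes "distinct xs" "successively E xs" "length xs \<ge> 2"
  shows "\<exists>g. arc g \<and> pathstart g = p (hd xs) \<and> pathfinish g = p (last xs) \<and> path_image g = draw xs"
  using assms
proof (induction xs rule: list_edges.induct)
  case (1 x y zs)
  then have E: "E x y" by simp
  have xy: "p x \<noteq> p y" using 1(2) E_V[OF E] E_V[OF E_sym[OF E]] p_inj by (auto simp: inj_on_def)
  \<comment> \<open>The arc \<open>\<gamma> {x, y}\<close> may run in either direction, and
    \<open>h\<close> is its version that starts at \<open>p x\<close>.\<close>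
  obtain h where h: "arc h" "pathstart h = p x" "pathfinish h = p y" "path_image h = path_image (\<gamma> {x, y})"
  proof (cases "pathstart (\<gamma> {x, y}) = p x")
    case True
    then have "pathfinish (\<gamma> {x, y}) = p y" using edge_ends[OF E] xy by (auto simp: doubleton_eq_iff)
    then show ?thesis using that True edge_arc[OF E] by blast
  next
    case False
    then have "pathfinish (\<gamma> {x, y}) = p x" "pathstart (\<gamma> {x, y}) = p y"
      using edge_ends[OF E] xy by (auto simp: doubleton_eq_iff)
    then show ?thesis using that[of "reversepath (\<gamma> {x, y})"] edge_arc[OF E] by (simp add: arc_reversepath)
  qed
  show ?case
  proof (cases zs)
    case Nil
    then show ?thesis using h by (intro exI[of _ h]) (simp add: draw_def)
  next
    case (Cons z zs')
    then obtain g where g: "arc g" "pathstart g = p y" "pathfinish g = p (last (y # zs))" "path_image g = draw (y # zs)"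
      using 1 by auto
    have "list_edges [x, y] \<inter> list_edges (y # zs) = {}"
      using list_edges_subset[of "{x, y}" "y # zs"] 1(2) by auto
    then have "draw [x, y] \<inter> draw (y # zs) \<subseteq> p ` (set [x, y] \<inter> set (y # zs))"
      using 1(3) by (intro draw_Int) auto
    then have sub: "path_image h \<inter> path_image g \<subseteq> {p y}"
      using 1(2) h g by (auto simp: draw_def)
    have "arc (h +++ g)" using arc_join[OF h(1) g(1)] h g sub by simp
    moreover have "path_image (h +++ g) = draw (x # y # zs)"
      using h g by (simp add: path_image_join draw_def)
    ultimately show ?thesis using h g by (intro exI[of _ "h +++ g"]) simp
  qed
qed auto

text \<open>A common edge of the two paths could only be \<open>ab\<close>. By \<open>ne\<close> one
  path has inner vertices, and such a path does not contain that edge.\<close>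

lemma draw_Int_ends:
  assumes d: "distinct (a # b # xs @ ys)" and x: "successively E (a # xs @ [b])"
    and y: "successively E (a # ys @ [b])" and ne: "xs \<noteq> [] \<or> ys \<noteq> []"
  shows "draw (a # xs @ [b]) \<inter> draw (a # ys @ [b]) = {p a, p b}"
proof -
  have "list_edges (a # xs @ [b]) \<inter> list_edges (a # ys @ [b]) = {}"
  proof (rule ccontr)
    assume "\<not> ?thesis"
    then obtain e where e: "e \<in> list_edges (a # xs @ [b])" "e \<in> list_edges (a # ys @ [b])" by blast
    then have "e \<subseteq> {a, b}" using list_edges_subset[OF e(1)] list_edges_subset[OF e(2)] d by auto
    moreover obtain u v where "e = {u, v}" "u \<noteq> v" using list_edgesE[OF e(1) x] E_irrefl by metis
    ultimately have "e = {a, b}" by auto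
    then show False using e list_edges_ends[of a xs b] list_edges_ends[of a ys b] d ne by auto
  qed
  from draw_Int[OF x y this] have "draw (a # xs @ [b]) \<inter> draw (a # ys @ [b]) \<subseteq> {p a, p b}"
    using d by auto
  moreover have "{p a, p b} \<subseteq> draw (a # xs @ [b]) \<inter> draw (a # ys @ [b])"
    using vert_draw[OF x] vert_draw[OF y] by auto
  ultimately show ?thesis by blast
qed

lemma inside_draw_vertex:
  assumes "x \<in> V" "successively E xs" "successively E ys" "distinct xs" "distinct ys" "length xs \<ge> 2" "length ys \<ge> 2"
  shows "p x \<notin> inside (draw xs \<union> draw ys)"
proof -
  obtain g h where "arc g" "path_image g = draw xs" "arc h" "path_image h = draw ys"
    using draw_arc assms by metis
  then have "closed (draw xs \<union> draw ys)" by (metis closed_Un closed_arc_image)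
  moreover have "draw xs \<union> draw ys \<subseteq> D" using draw_D assms by auto
  ultimately show ?thesis using inside_not_frontier_outside vert_D[OF assms(1)] by blast
qed

text \<open>By \<open>theta_inside\<close> one of the three paths is drawn inside the circle of the
  other two. A path with an inner vertex cannot be, since that vertex would be cut off from the
  outer face. So it is the third path, and it is a single edge.\<close>

lemma theta_chord:
  assumes d: "distinct (a # b # xs @ ys @ zs)" and x: "successively E (a # xs @ [b])"
    and y: "successively E (a # ys @ [b])" and z: "successively E (a # zs @ [b])"
    and ne: "xs \<noteq> []" "ys \<noteq> []" and V: "set xs \<union> set ys \<union> set zs \<subseteq> V"
  shows "zs = []" "draw (a # zs @ [b]) - {p a, p b} \<subseteq> inside (draw (a # xs @ [b]) \<union> draw (a # ys @ [b]))"
proof -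
  let ?X = "a # xs @ [b]" and ?Y = "a # ys @ [b]" and ?Z = "a # zs @ [b]"
  have dd: "distinct ?X" "distinct ?Y" "distinct ?Z" using d by auto
  obtain g where g: "arc g" "pathstart g = p a" "pathfinish g = p b" "path_image g = draw ?X"
    using draw_arc[OF dd(1) x] by auto
  obtain h where h: "arc h" "pathstart h = p a" "pathfinish h = p b" "path_image h = draw ?Y"
    using draw_arc[OF dd(2) y] by auto
  obtain k where k: "arc k" "pathstart k = p a" "pathfinish k = p b" "path_image k = draw ?Z"
    using draw_arc[OF dd(3) z] by auto
  have xy: "draw ?X \<inter> draw ?Y = {p a, p b}" and xz: "draw ?X \<inter> draw ?Z = {p a, p b}" and yz: "draw ?Y \<inter> draw ?Z = {p a, p b}"
    using d ne x y z by (intro draw_Int_ends; auto)+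
  have "E a (hd xs)" "E (last xs) b" using x ne by (auto simp: successively_Cons successively_append_iff)
  then have ab: "a \<in> V" "b \<in> V" using E_V E_sym by blast+
  have notin: "\<not> draw (a # us @ [b]) - {p a, p b} \<subseteq> inside (draw vs \<union> draw ws)"
    if "us \<noteq> []" "distinct (a # us @ [b])" "successively E (a # us @ [b])" "set us \<subseteq> V"
      "vs \<in> {?X, ?Y, ?Z}" "ws \<in> {?X, ?Y, ?Z}" for us vs ws
  proof -
    obtain u where u: "u \<in> set us" using \<open>us \<noteq> []\<close> last_in_set by metis
    then have "u \<in> V" "u \<noteq> a" "u \<noteq> b" using that by auto
    then have "p u \<notin> {p a, p b}" using p_inj ab by (auto simp: inj_on_def)
    moreover have "p u \<in> draw (a # us @ [b])" using vert_draw[OF that(3)] u by auto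
    moreover have "p u \<notin> inside (draw vs \<union> draw ws)"
      using that(5,6) x y z dd by (intro inside_draw_vertex[OF \<open>u \<in> V\<close>]) auto
    ultimately show ?thesis by blast
  qed
  have "draw ?Z - {p a, p b} \<subseteq> inside (draw ?X \<union> draw ?Y) \<or>
    draw ?Y - {p a, p b} \<subseteq> inside (draw ?X \<union> draw ?Z) \<or>
    draw ?X - {p a, p b} \<subseteq> inside (draw ?Y \<union> draw ?Z)"
    using theta_inside[OF g(1-3) h(1-3) k(1-3)] xy xz yz unfolding g(4) h(4) k(4) by blast
  then show sub: "draw ?Z - {p a, p b} \<subseteq> inside (draw ?X \<union> draw ?Y)"
    using notin[of ys ?X ?Z] notin[of xs ?Y ?Z] ne dd x y V by auto
  then show "zs = []" using notin[of zs ?X ?Y] dd z V by auto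
qed

text \<open>The cycle is the union of two paths from \<open>a\<close> to \<open>c\<close> and also
  of two paths from \<open>b\<close> to \<open>d\<close>. Applied to both decompositions,
  \<open>theta_chord\<close> puts both chords inside the same closed curve, and
  \<open>crossing_arcs\<close> rules that out.\<close>

lemma no_crossing:
  assumes d: "distinct (a # c # xs @ b # xs' @ ys @ d # ys')"
    and x: "successively E (a # xs @ b # xs' @ [c])" and y: "successively E (a # ys @ d # ys' @ [c])"
    and V: "set xs \<union> set xs' \<union> set ys \<union> set ys' \<subseteq> V"
    and ac: "E a c" and bd: "E b d"
  shows False
proof -
  let ?X = "a # (xs @ b # xs') @ [c]" and ?Y = "a # (ys @ d # ys') @ [c]"
  \<comment> \<open>The same cycle, cut at \<open>b\<close> and \<open>d\<close>.\<close>
  let ?X' = "b # (xs' @ c # rev ys') @ [d]" and ?Y' = "b # (rev xs @ a # ys) @ [d]"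
  have s_rev: "successively E (rev us) \<longleftrightarrow> successively E us" for us
    unfolding successively_rev using E_sym by (intro arg_cong2[of _ _ _ _ successively] ext refl) auto
  have "b \<in> V" "d \<in> V" "a \<in> V" "c \<in> V" using ac bd E_sym E_V by blast+
  then have V': "set (xs @ b # xs') \<union> set (ys @ d # ys') \<union> set [] \<subseteq> V"
    "set (xs' @ c # rev ys') \<union> set (rev xs @ a # ys) \<union> set [] \<subseteq> V" using V by auto
  have x': "successively E (a # xs @ [b])" "successively E (b # xs' @ [c])"
    using x successively_append_iff[of E "a # xs" "b # xs' @ [c]"] successively_append_iff[of E "a # xs" "[b]"] by auto
  have y': "successively E (a # ys @ [d])" "successively E (d # ys' @ [c])"
    using y successively_append_iff[of E "a # ys" "d # ys' @ [c]"] successively_append_iff[of E "a # ys" "[d]"] by auto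
  have r: "successively E (b # rev xs @ [a])" "successively E (c # rev ys' @ [d])"
    using x'(1) y'(2) s_rev[of "a # xs @ [b]"] s_rev[of "d # ys' @ [c]"] by auto
  have sX': "successively E ?X'"
    using x'(2) r(2) successively_append_iff[of E "b # xs'" "c # rev ys' @ [d]"]
      successively_append_iff[of E "b # xs'" "[c]"] by auto
  have sY': "successively E ?Y'"
    using y'(1) r(1) successively_append_iff[of E "b # rev xs" "a # ys @ [d]"]
      successively_append_iff[of E "b # rev xs" "[a]"] by auto
  have "list_edges ?X = list_edges (a # xs @ [b]) \<union> list_edges (b # xs' @ [c])"
    using list_edges_append[of "a # xs" b "xs' @ [c]"] by simp
  moreover have "list_edges ?Y = list_edges (a # ys @ [d]) \<union> list_edges (d # ys' @ [c])"
    using list_edges_append[of "a # ys" d "ys' @ [c]"] by simp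
  moreover have "list_edges ?X' = list_edges (b # xs' @ [c]) \<union> list_edges (d # ys' @ [c])"
    using list_edges_append[of "b # xs'" c "rev ys' @ [d]"] list_edges_rev[of "d # ys' @ [c]"] by simp
  moreover have "list_edges ?Y' = list_edges (a # xs @ [b]) \<union> list_edges (a # ys @ [d])"
    using list_edges_append[of "b # rev xs" a "ys @ [d]"] list_edges_rev[of "a # xs @ [b]"] by simp
  ultimately have "list_edges ?X' \<union> list_edges ?Y' = list_edges ?X \<union> list_edges ?Y"
    by blast
  then have eq: "draw ?X' \<union> draw ?Y' = draw ?X \<union> draw ?Y"
    unfolding draw_def by (metis UN_Un)
  have dX: "distinct (a # c # (xs @ b # xs') @ (ys @ d # ys') @ [])" using d by auto
  have sX: "successively E ?X" and sY: "successively E ?Y" and sZ: "successively E (a # [] @ [c])"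
    using x y ac by auto
  have in1: "draw (a # [] @ [c]) - {p a, p c} \<subseteq> inside (draw ?X \<union> draw ?Y)"
    by (rule theta_chord(2)[OF dX sX sY sZ _ _ V'(1)]) auto
  have dX': "distinct (b # d # (xs' @ c # rev ys') @ (rev xs @ a # ys) @ [])" using d by auto
  have sZ': "successively E (b # [] @ [d])" using bd by simp
  have in2: "draw (b # [] @ [d]) - {p b, p d} \<subseteq> inside (draw ?X' \<union> draw ?Y')"
    by (rule theta_chord(2)[OF dX' sX' sY' sZ' _ _ V'(2)]) auto
  have dd: "distinct ?X" "distinct ?Y" "distinct (a # [] @ [c])" "distinct (b # [] @ [d])" using d by auto
  obtain g where g: "arc g" "pathstart g = p a" "pathfinish g = p c" "path_image g = draw ?X"
    using draw_arc[OF dd(1) sX] by auto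
  obtain h where h: "arc h" "pathstart h = p a" "pathfinish h = p c" "path_image h = draw ?Y"
    using draw_arc[OF dd(2) sY] by auto
  obtain k where k: "arc k" "pathstart k = p a" "pathfinish k = p c" "path_image k = draw (a # [] @ [c])"
    using draw_arc[OF dd(3) sZ] by auto
  obtain l where l: "arc l" "pathstart l = p b" "pathfinish l = p d" "path_image l = draw (b # [] @ [d])"
    using draw_arc[OF dd(4) sZ'] by auto
  have i1: "draw ?X \<inter> draw ?Y = {p a, p c}"
    by (rule draw_Int_ends) (use d sX sY in auto)
  have i2: "draw ?X \<inter> draw (a # [] @ [c]) = {p a, p c}"
    by (rule draw_Int_ends) (use d sX sZ in auto)
  have i3: "draw ?Y \<inter> draw (a # [] @ [c]) = {p a, p c}"
    by (rule draw_Int_ends) (use d sY sZ in auto)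
  have "draw (b # [] @ [d]) \<inter> draw (a # [] @ [c]) \<subseteq> p ` (set (b # [] @ [d]) \<inter> set (a # [] @ [c]))"
    by (rule draw_Int[OF sZ' sZ]) (use d in \<open>auto simp: doubleton_eq_iff\<close>)
  then have i4: "draw (b # [] @ [d]) \<inter> draw (a # [] @ [c]) = {}" using d by auto
  have "p b \<in> draw ?X" "p d \<in> draw ?Y" using vert_draw[OF sX, of b] vert_draw[OF sY, of d] by auto
  from crossing_arcs[OF g(1-3) h(1-3) k(1-3), unfolded g(4) h(4) k(4), OF i1 i2 i3 in1 l(1-3), unfolded l(4),
      OF in2[unfolded eq] i4 this]
  show False .
qed

end

section \<open>Hamiltonian cycle and chords\<close>

text \<open>The geometry enters only through \<open>no_theta\<close> and \<open>no_crossing\<close>;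
  everything in this locale is combinatorial.\<close>

locale outerplanar_graph =
  fixes V :: "'a set" and E :: "'a \<Rightarrow> 'a \<Rightarrow> bool"
  assumes fin: "finite V" and card3: "card V \<ge> 3"
    and E_sym: "E x y \<Longrightarrow> E y x" and E_irrefl: "\<not> E x x" and E_V: "E x y \<Longrightarrow> x \<in> V"
    and degree: "card {y. E x y} \<le> 3"
    and two_conn: "v \<in> V \<Longrightarrow> x \<in> V \<Longrightarrow> y \<in> V \<Longrightarrow> x \<noteq> v \<Longrightarrow> y \<noteq> v \<Longrightarrow>
      (\<lambda>x y. E x y \<and> x \<noteq> v \<and> y \<noteq> v)\<^sup>*\<^sup>* x y"
    and no_theta: "distinct (a # b # xs @ ys @ zs) \<Longrightarrow> successively E (a # xs @ [b]) \<Longrightarrow>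
      successively E (a # ys @ [b]) \<Longrightarrow> successively E (a # zs @ [b]) \<Longrightarrow> xs \<noteq> [] \<Longrightarrow> ys \<noteq> [] \<Longrightarrow> zs = []"
    and no_crossing: "distinct (a # c # xs @ b # xs' @ ys @ d # ys') \<Longrightarrow>
      successively E (a # xs @ b # xs' @ [c]) \<Longrightarrow> successively E (a # ys @ d # ys' @ [c]) \<Longrightarrow>
      E a c \<Longrightarrow> E b d \<Longrightarrow> False"
begin

lemma successively_rev_E: "successively E (rev us) \<longleftrightarrow> successively E us"
  unfolding successively_rev using E_sym by (intro arg_cong2[of _ _ _ _ successively] ext refl) auto

lemma E_V2: "E x y \<Longrightarrow> y \<in> V"
  using E_V[OF E_sym] .

lemma finite_neighbours: "finite {y. E x y}"
proof (rule finite_subset[OF _ fin])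
  show "{y. E x y} \<subseteq> V" by (rule subsetI) (simp add: E_V2)
qed

text \<open>The walk is followed back from its end, and a path is kept that meets \<open>S\<close>
  only in the vertex \<open>b\<close> after its last one. When \<open>u\<close> already lies on this
  path, the part before \<open>u\<close> is dropped.\<close>

lemma first_hit:
  assumes "(\<lambda>x y. E x y \<and> x \<noteq> v \<and> y \<noteq> v)\<^sup>*\<^sup>* u w" "w \<in> S" "u \<notin> S" "u \<noteq> v"
  shows "\<exists>xs b. distinct (u # xs) \<and> successively E (u # xs) \<and> E (last (u # xs)) b \<and> b \<in> S \<and> b \<noteq> v \<and>
    set (u # xs) \<inter> S = {} \<and> v \<notin> set (u # xs)"
  using assms
proof (induction rule: converse_rtranclp_induct)
  case (step u u')
  show ?case
  proof (cases "u' \<in> S")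
    case True
    then show ?thesis using step by (intro exI[of _ "[]"] exI[of _ u']) auto
  next
    case False
    then obtain xs b where *: "distinct (u' # xs)" "successively E (u' # xs)" "E (last (u' # xs)) b" "b \<in> S" "b \<noteq> v"
      "set (u' # xs) \<inter> S = {}" "v \<notin> set (u' # xs)" using step by blast
    show ?thesis
    proof (cases "u \<in> set (u' # xs)")
      case True
      then obtain ps qs where q: "u' # xs = ps @ u # qs" by (meson split_list)
      have "distinct (ps @ u # qs)" "successively E (ps @ u # qs)" "E (last (ps @ u # qs)) b"
        "set (ps @ u # qs) \<inter> S = {}" "v \<notin> set (ps @ u # qs)" using * unfolding q by blast+
      then show ?thesis using *(4,5)
        by (intro exI[of _ qs] exI[of _ b]) (auto simp: successively_append_iff)
    next
      case False
      then show ?thesis using * step by (intro exI[of _ "u' # xs"] exI[of _ b]) auto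
    qed
  qed
qed auto

definition cyc :: "'a list \<Rightarrow> bool" where
  "cyc xs \<longleftrightarrow> distinct xs \<and> 3 \<le> length xs \<and> successively E xs \<and> E (last xs) (hd xs)"

lemma cyc_rotate: "cyc (us @ vs) \<Longrightarrow> cyc (vs @ us)"
  by (cases "us = []"; cases "vs = []") (auto simp: cyc_def successively_append_iff)

lemma cyc_V: "cyc xs \<Longrightarrow> set xs \<subseteq> V"
proof
  fix x assume "cyc xs" "x \<in> set xs"
  then obtain us vs where "xs = us @ x # vs" by (meson split_list)
  then have "cyc (x # vs @ us)" using cyc_rotate[of us "x # vs"] \<open>cyc xs\<close> by simp
  then have "E (last (x # vs @ us)) x" by (simp add: cyc_def)
  then show "x \<in> V" using E_sym E_V by blast
qed

text \<open>The part of the cycle from \<open>c\<close> back to \<open>a\<close> is reversed, so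
  that both halves run from \<open>a\<close> to \<open>c\<close> as in
  \<open>no_crossing\<close>.\<close>

lemma cyc_crossing:
  assumes "cyc (a # B @ b # C @ c # F @ d # G)" "E a c" "E b d"
  shows False
proof -
  let ?Y = "c # F @ d # G @ [a]"
  have 1: "distinct (a # B @ b # C @ c # F @ d # G)"
    and 2: "successively E (a # B @ b # C @ c # F @ d # G)" "E (last (d # G)) a"
    using assms(1) by (auto simp: cyc_def)
  have "successively E (c # F @ d # G)" and X: "successively E (a # B @ b # C @ [c])"
    using 2(1) successively_append_iff[of E "a # B @ b # C" "c # F @ d # G"]
      successively_append_iff[of E "a # B @ b # C" "[c]"] by auto
  then have "successively E ?Y" using 2(2) successively_append_iff[of E "c # F @ d # G" "[a]"] by auto
  then have "successively E (a # rev G @ d # rev F @ [c])"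
    using successively_rev_E[of ?Y] by simp
  then show False using no_crossing[OF _ X _ assms(2,3), of "rev G" "rev F"] 1 by auto
qed

lemma third_vertex: "\<exists>z\<in>V. z \<noteq> x \<and> z \<noteq> y"
proof (rule ccontr)
  assume "\<not> ?thesis"
  then have "V \<subseteq> {x, y}" by blast
  then have "card V \<le> card {x, y}" by (intro card_mono) auto
  also have "\<dots> \<le> 2" by (simp add: card_insert_if)
  finally show False using card3 by simp
qed

text \<open>Some vertex \<open>v\<close> has two neighbours, and a path between them that avoids
  \<open>v\<close> closes up to a cycle.\<close>

lemma cyc_exists: "\<exists>xs. cyc xs"
proof -
  obtain v where v: "v \<in> V" using third_vertex by blast
  \<comment> \<open>After deletion of \<open>x\<close> the vertex \<open>v\<close> still reaches a
    third vertex, so it has a neighbour other than \<open>x\<close>.\<close>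
  have step: "\<exists>u. E v u \<and> u \<noteq> x" if x: "x \<in> V" "x \<noteq> v" for x
  proof -
    obtain y where y: "y \<in> V" "y \<noteq> v" "y \<noteq> x" using third_vertex by blast
    have "(\<lambda>a b. E a b \<and> a \<noteq> x \<and> b \<noteq> x)\<^sup>*\<^sup>* v y" using two_conn v y x by blast
    then show ?thesis by (rule converse_rtranclpE) (use y in auto)
  qed
  obtain x where "x \<in> V" "x \<noteq> v" using third_vertex by blast
  then obtain u where u: "E v u" using step by blast
  have u': "u \<in> V" "u \<noteq> v" using u E_irrefl E_V E_V2 by blast+
  then obtain w where w: "E v w" "w \<noteq> u" using step by blast
  have w': "w \<in> V" "w \<noteq> v" using w E_irrefl E_V E_V2 by blast+
  have "(\<lambda>x y. E x y \<and> x \<noteq> v \<and> y \<noteq> v)\<^sup>*\<^sup>* u w" using two_conn u' w' v by blast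
  then obtain xs b where "distinct (u # xs)" "successively E (u # xs)" "E (last (u # xs)) b" "b \<in> {w}"
    "set (u # xs) \<inter> {w} = {}" "v \<notin> set (u # xs)"
    using first_hit[of v u w "{w}"] w u' by blast
  moreover from this have "successively E ((u # xs) @ [w])"
    by (subst successively_append_iff) auto
  moreover have "E w v" using w E_sym by blast
  ultimately have "cyc (v # u # xs @ [w])"
    using u w w' by (auto simp: cyc_def)
  then show ?thesis by blast
qed

lemma hamiltonian: "\<exists>xs. cyc xs \<and> set xs = V"
proof -
  have len: "length xs \<le> card V" if "cyc xs" for xs
    using distinct_card[of xs] card_mono[OF fin cyc_V[OF that]] that by (auto simp: cyc_def)
  obtain xs where xs: "cyc xs" and max: "\<And>ys. cyc ys \<Longrightarrow> length ys \<le> length xs"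
  proof -
    obtain ys where "cyc ys" using cyc_exists by blast
    moreover have "\<forall>y. cyc y \<longrightarrow> length y < Suc (card V)" using len by (simp add: less_Suc_eq_le)
    ultimately show ?thesis using ex_has_greatest_nat[of cyc ys length "Suc (card V)"] that by blast
  qed
  have "set xs = V"
  proof (rule ccontr)
    assume "set xs \<noteq> V"
    then obtain v where v: "v \<in> V" "v \<notin> set xs" using cyc_V[OF xs] by blast
    have xs0: "hd xs \<in> set xs" using xs by (cases xs) (auto simp: cyc_def)
    then have h: "hd xs \<in> V" using cyc_V[OF xs] by blast
    \<comment> \<open>Any walk from \<open>v\<close> to the cycle will do; \<open>two_conn\<close>
      yields walks that avoid a vertex, so some \<open>x\<close> other than both ends is
      deleted.\<close>
    obtain x where x: "x \<in> V" "x \<noteq> v" "x \<noteq> hd xs" using third_vertex by blast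
    have nx: "v \<noteq> x" "hd xs \<noteq> x" using x by auto
    have "(\<lambda>a b. E a b \<and> a \<noteq> x \<and> b \<noteq> x)\<^sup>*\<^sup>* v (hd xs)" by (rule two_conn[OF x(1) v(1) h nx])
    then obtain ys a where ys: "E (last (v # ys)) a" "a \<in> set xs" "set (v # ys) \<inter> set xs = {}"
      using first_hit[OF _ xs0 v(2) nx(1)] by blast
    let ?z = "last (v # ys)"
    have "?z \<in> set (v # ys)" by (rule last_in_set) simp
    then have z: "?z \<notin> set xs" "?z \<in> V" "?z \<noteq> a" using ys E_V by blast+
    obtain us vs where uv: "xs = us @ a # vs" using ys(2) by (meson split_list)
    then have c1: "cyc (a # vs @ us)" using cyc_rotate[of us "a # vs"] xs by simp
    then have "vs @ us \<noteq> []" by (auto simp: cyc_def)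
    then obtain w where w: "w \<in> set (vs @ us)" using last_in_set by blast
    then have wS: "w \<in> set xs - {a}" using uv xs by (auto simp: cyc_def)
    have aw: "a \<in> V" "w \<in> V" "w \<noteq> a" using wS ys(2) cyc_V[OF xs] by auto
    \<comment> \<open>Deleting \<open>a\<close> makes the second path return to the cycle at a
      vertex \<open>b\<close> different from \<open>a\<close>.\<close>
    have "(\<lambda>x y. E x y \<and> x \<noteq> a \<and> y \<noteq> a)\<^sup>*\<^sup>* ?z w" by (rule two_conn[OF aw(1) z(2) aw(2) z(3) aw(3)])
    then obtain zs b where zs: "distinct (?z # zs)" "successively E (?z # zs)" "E (last (?z # zs)) b"
      "b \<in> set xs - {a}" "set (?z # zs) \<inter> (set xs - {a}) = {}" "a \<notin> set (?z # zs)"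
      using first_hit[OF _ wS, of a ?z] z by blast
    then have "b \<in> set (vs @ us)" using uv by auto
    then obtain P R where PR: "vs @ us = P @ b # R" by (meson split_list)
    have len_xs: "length xs = length (a # P @ b # R)"
      using uv PR by (metis length_append length_Cons add.commute add_Suc_right)
    have c2: "cyc (a # P @ b # R)" using c1 PR by simp
    have set_xs: "set xs = set (a # P @ b # R)" using uv PR by (metis set_append list.set(2) Un_commute Un_insert_left)
    have disj: "set (?z # zs) \<inter> set (a # P @ b # R) = {}" using zs(5,6) unfolding set_xs by auto
    let ?W = "?z # zs"
    have d: "distinct (a # P @ b # R)" and s: "successively E (a # P @ b # R)" "E (last (b # R)) a"
      using c2 by (auto simp: cyc_def)
    have za: "E a ?z" using ys(1) E_sym by blast
    have sW: "successively E (a # ?W @ [b])"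
      using za zs(2,3) successively_append_iff[of E "a # ?W" "[b]"] by auto
    have sP: "successively E (a # P @ [b])" and sR: "successively E (b # R)"
      using s(1) successively_append_iff[of E "a # P" "b # R"] successively_append_iff[of E "a # P" "[b]"] by auto
    show False
    \<comment> \<open>\<open>P\<close> and \<open>R\<close> are the inner parts of the cycle between
      \<open>a\<close> and \<open>b\<close>, and \<open>?W\<close> joins \<open>a\<close> and
      \<open>b\<close> off the cycle. If \<open>P\<close> and \<open>R\<close> are nonempty, the
      three paths contradict \<open>no_theta\<close>; otherwise \<open>?W\<close> replaces the edge
      \<open>ab\<close> and lengthens the cycle.\<close>
    proof (cases "P = [] \<or> R = []")
      case False
      have "successively E (b # R @ [a])"
        using sR s(2) successively_append_iff[of E "b # R" "[a]"] by auto
      then have "successively E (a # rev R @ [b])" using successively_rev_E[of "b # R @ [a]"] by simp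
      moreover have "distinct (a # b # P @ rev R @ ?W)" using d zs(1) disj by auto
      ultimately have "?W = []" using no_theta[OF _ sP _ sW] False by blast
      then show False by simp
    next
      case True
      then show False
      proof
        assume P: "P = []"
        have "successively E (a # ?W @ b # R)"
          using sW sR successively_append_iff[of E "a # ?W" "b # R"] successively_append_iff[of E "a # ?W" "[b]"] by auto
        then have "cyc (a # ?W @ b # R)" using d zs(1) disj s(2) P by (auto simp: cyc_def)
        from max[OF this] show False using len_xs P by simp
      next
        assume R: "R = []"
        have "successively E (b # rev ?W @ [a])" using sW successively_rev_E[of "a # ?W @ [b]"] by simp
        then have "successively E ((a # P @ [b]) @ rev ?W)"
          using sP successively_append_iff[of E "b # rev ?W" "[a]"] successively_append_iff[of E "a # P @ [b]" "rev ?W"]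
          by (auto simp: successively_Cons)
        moreover have "E (last ((a # P @ [b]) @ rev ?W)) a" using za E_sym by simp
        ultimately have "cyc ((a # P @ [b]) @ rev ?W)" using d zs(1) disj R by (auto simp: cyc_def)
        from max[OF this] show False using len_xs R by simp
      qed
    qed
  qed
  then show ?thesis using xs by blast
qed


section \<open>Colourings of the pieces of a cycle\<close>

definition good_on :: "('a \<Rightarrow> bool option) \<Rightarrow> 'a set \<Rightarrow> bool" where
  "good_on f T \<longleftrightarrow> (\<forall>x\<in>T. \<forall>y\<in>T. E x y \<longrightarrow> f x \<noteq> f y) \<and>
     (\<forall>x\<in>T. \<forall>y\<in>T. \<forall>z\<in>T. E x y \<longrightarrow> E x z \<longrightarrow> f y = None \<longrightarrow> f z = None \<longrightarrow> y = z)"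

lemma good_onD_proper: "good_on f T \<Longrightarrow> E x y \<Longrightarrow> x \<in> T \<Longrightarrow> y \<in> T \<Longrightarrow> f x \<noteq> f y"
  unfolding good_on_def by blast

lemma good_onD_far: "good_on f T \<Longrightarrow> E x y \<Longrightarrow> E x z \<Longrightarrow> x \<in> T \<Longrightarrow> y \<in> T \<Longrightarrow> z \<in> T \<Longrightarrow> f y = None \<Longrightarrow> f z = None \<Longrightarrow> y = z"
  unfolding good_on_def by blast

lemma good_swap_to:
  assumes "good_on f T" "f x \<noteq> None"
  obtains g where "good_on g T" "g x = Some b" "\<And>y. g y = None \<longleftrightarrow> f y = None"
proof (cases "f x = Some b")
  case True
  then show ?thesis using that assms by blast
next
  case False
  have "map_option Not u = map_option Not v \<longleftrightarrow> u = v" for u v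
    by (cases u; cases v) auto
  then have "good_on (map_option Not \<circ> f) T" using assms(1) by (simp add: good_on_def)
  moreover have "(map_option Not \<circ> f) x = Some b" using False assms(2) by auto
  ultimately show ?thesis using that by simp
qed

definition free_piece :: "'a list \<Rightarrow> bool" where
  "free_piece L \<longleftrightarrow> (\<exists>f. good_on f (set L) \<and> f (hd L) \<noteq> None \<and> f (last L) \<noteq> None \<and>
     f (hd (tl L)) \<noteq> None \<and> f (last (butlast L)) \<noteq> None)"

definition tight_piece :: "'a list \<Rightarrow> bool" where
  "tight_piece L \<longleftrightarrow> (\<exists>f. good_on f (set L) \<and> f (hd L) = None \<and> f (last L) \<noteq> None) \<and>
     (\<exists>f. good_on f (set L) \<and> f (hd L) \<noteq> None \<and> f (last L) = None) \<and>
     (\<exists>f. good_on f (set L) \<and> f (hd L) \<noteq> None \<and> f (last L) \<noteq> None)"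

lemma split_nth4:
  assumes "i < k" "k < j" "j < l" "l < length xs"
  obtains A B C F G where "xs = A @ xs ! i # B @ xs ! k # C @ xs ! j # F @ xs ! l # G"
proof -
  have split: "drop (Suc i) xs = take (k - Suc i) (drop (Suc i) xs) @ xs ! k # drop (Suc k) xs"
    if "i < k" "k < length xs" for i k
    using that id_take_nth_drop[of "k - Suc i" "drop (Suc i) xs"] by simp
  have "xs = take i xs @ xs ! i # drop (Suc i) xs" using id_take_nth_drop[of i xs] assms by simp
  then show ?thesis
    using that split[of i k] split[of k j] split[of j l] assms by (metis less_trans)
qed

text \<open>Numbering the vertices of \<open>L\<close> turns its chords into an instance of
  \<open>chords\<close>. They form a matching by the degree bound and by the hypotheses on
  \<open>a\<close> and \<open>b\<close>, and they do not cross by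
  \<open>cyc_crossing\<close>.\<close>

lemma piece_free_or_tight:
  assumes cyc: "cyc (L @ R)" and L: "L = a # P @ [b]" "P \<noteq> []" and ab: "E a b"
    and P: "\<And>x y. x \<in> set P \<Longrightarrow> E x y \<Longrightarrow> y \<in> set L"
    and a: "\<And>y. E a y \<Longrightarrow> y \<in> set L \<Longrightarrow> y = hd P \<or> y = b"
    and b: "\<And>y. E b y \<Longrightarrow> y \<in> set L \<Longrightarrow> y = last P \<or> y = a"
  shows "free_piece L \<or> tight_piece L"
proof -
  define m where "m = Suc (length P)"
  define M where "M i j \<longleftrightarrow> i \<le> m \<and> j \<le> m \<and> E (L ! i) (L ! j) \<and> (Suc i < j \<or> Suc j < i)" for i j
  have len: "length L = Suc m" using L by (simp add: m_def)
  have m2: "2 \<le> m" using L by (cases P) (auto simp: m_def)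
  have dist: "distinct L" and succ: "successively E L" using cyc by (auto simp: cyc_def successively_append_iff)
  have L_eq: "L ! i = L ! j \<longleftrightarrow> i = j" if "i \<le> m" "j \<le> m" for i j
    using nth_eq_iff_index_eq[OF dist] that len by simp
  have inj: "inj_on ((!) L) {..m}" by (intro inj_onI) (use L_eq in blast)
  have L_in: "L ! i \<in> set L" if "i \<le> m" for i using that len by simp
  have L0: "L ! 0 = a" "L ! m = b" "L ! 1 = hd P" "L ! (m - 1) = last P" "hd L = a" "last L = b"
    "hd (tl L) = hd P" "last (butlast L) = last P"
    using L by (auto simp: m_def nth_append hd_conv_nth last_conv_nth nth_Cons' butlast_append)
  have step: "E (L ! i) (L ! Suc i)" if "i < m" for i
    using succ that len by (auto simp: successively_conv_nth)
  interpret chords M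
  proof
    show "M i j \<Longrightarrow> M j i" for i j using E_sym by (auto simp: M_def)
    show "M i j \<Longrightarrow> i \<le> j \<Longrightarrow> Suc i < j" for i j by (auto simp: M_def)
    show "j = k" if M: "M i j" "M i k" for i j k
    proof -
      have e: "i \<le> m" "j \<le> m" "k \<le> m" "E (L ! i) (L ! j)" "E (L ! i) (L ! k)"
        "Suc i < j \<or> Suc j < i" "Suc i < k \<or> Suc k < i" using M by (auto simp: M_def)
      consider "i = 0" | "i = m" | "0 < i" "i < m" using e by linarith
      then show ?thesis
      proof cases
        case 1
        then have "L ! j = L ! 1 \<or> L ! j = L ! m" "L ! k = L ! 1 \<or> L ! k = L ! m"
          using a[of "L ! j"] a[of "L ! k"] e L_in unfolding L0(2,3) by (auto simp: L0(1))
        moreover have "1 \<le> m" "m \<le> m" using m2 by auto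
        ultimately have "j = 1 \<or> j = m" "k = 1 \<or> k = m" using L_eq e(2,3) by metis+
        then show ?thesis using e(6,7) 1 by auto
      next
        case 2
        then have "L ! j = L ! (m - 1) \<or> L ! j = L ! 0" "L ! k = L ! (m - 1) \<or> L ! k = L ! 0"
          using b[of "L ! j"] b[of "L ! k"] e L_in unfolding L0(1,4) by (auto simp: L0(2))
        moreover have "m - 1 \<le> m" "0 \<le> m" by auto
        ultimately have "j = m - 1 \<or> j = 0" "k = m - 1 \<or> k = 0" using L_eq e(2,3) by metis+
        then show ?thesis using e(6,7) 2 by auto
      next
        \<comment> \<open>An inner vertex has two neighbours on the path, so two different chords
          would give it degree at least four.\<close>
        case 3
        show ?thesis
        proof (rule ccontr)
          assume "j \<noteq> k"
          then have "i - 1 \<notin> {Suc i, j, k}" "Suc i \<notin> {j, k}" "j \<notin> {k}" using e(6,7) 3 by auto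
          then have "card {i - 1, Suc i, j, k} = 4" by (simp add: card_insert_if del: One_nat_def)
          moreover have "{i - 1, Suc i, j, k} \<subseteq> {..m}" using e(2,3) 3 by auto
          ultimately have "card ((!) L ` {i - 1, Suc i, j, k}) = 4"
            by (simp only: card_image[OF inj_on_subset[OF inj]])
          moreover have "(!) L ` {i - 1, Suc i, j, k} \<subseteq> {y. E (L ! i) y}"
            using e step[of i] E_sym[OF step[of "i - 1"]] 3 by auto
          ultimately have "4 \<le> card {y. E (L ! i) y}" using card_mono[OF finite_neighbours] by metis
          then show False using degree[of "L ! i"] by simp
        qed
      qed
    qed
    show False if ijkl: "M i j" "M k l" "i < k" "k < j" "j < l" for i j k l
    proof -
      have l: "l < length L" using ijkl(2) len by (auto simp: M_def)
      obtain A B C F G where s: "L = A @ L ! i # B @ L ! k # C @ L ! j # F @ L ! l # G"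
        using split_nth4[OF ijkl(3-5) l] by blast
      have "cyc (A @ L ! i # B @ L ! k # C @ L ! j # F @ L ! l # G @ R)"
        using cyc arg_cong[OF s, of "\<lambda>t. t @ R"] by (simp only: append_Cons append_assoc)
      then have "cyc (L ! i # B @ L ! k # C @ L ! j # F @ L ! l # (G @ R @ A))"
        using cyc_rotate[of A "L ! i # B @ L ! k # C @ L ! j # F @ L ! l # G @ R"] by simp
      then show False using cyc_crossing ijkl(1,2) unfolding M_def by blast
    qed
  qed
  \<comment> \<open>The edge \<open>ab\<close> joins the first and last position and counts as a
    chord, so the result on intervals covers all of \<open>L\<close>.\<close>
  have "M 0 m" using ab m2 by (auto simp: M_def L0)
  then have PQ: "free_chord 0 m \<or> tight_chord 0 m" using chord_free_or_tight m2 by simp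
  define idx where "idx = inv_into {..m} ((!) L)"
  have idx: "idx (L ! i) = i" if "i \<le> m" for i
    unfolding idx_def using inj that by (simp add: inv_into_f_f)
  have setL: "set L = (!) L ` {..m}" using len by (auto simp: set_conv_nth image_def less_Suc_eq_le)
  have adj: "adj i j" if "E (L ! i) (L ! j)" "i \<le> m" "j \<le> m" for i j
  proof -
    have "i \<noteq> j" using that E_irrefl by auto
    then show ?thesis using that by (auto simp: adj_def M_def)
  qed
  have good_on: "good_on (c \<circ> idx) (set L)" if "valid_on c 0 (Suc m)" for c
  proof -
    have "c i \<noteq> c j" if "E (L ! i) (L ! j)" "i \<le> m" "j \<le> m" for i j
      using valid_onD_proper[OF \<open>valid_on c 0 (Suc m)\<close> adj[OF that]] that by simp
    moreover have "L ! j = L ! k" if "E (L ! i) (L ! j)" "E (L ! i) (L ! k)" "i \<le> m" "j \<le> m" "k \<le> m" "c j = None" "c k = None"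
      for i j k
      using valid_onD_far[OF \<open>valid_on c 0 (Suc m)\<close> adj[OF that(1,3,4)] adj[OF that(2,3,5)]] that by (rule_tac arg_cong[of j k]) simp
    ultimately show ?thesis unfolding good_on_def setL by (auto simp: idx)
  qed
  have val: "(c \<circ> idx) (hd L) = c 0" "(c \<circ> idx) (last L) = c m" "(c \<circ> idx) (hd (tl L)) = c (Suc 0)"
    "(c \<circ> idx) (last (butlast L)) = c (m - 1)" for c
    using idx[of 0] idx[of m] idx[of 1, unfolded L0(3)] idx[of "m - 1", unfolded L0(4)] m2 by (simp_all add: L0)
  from PQ show ?thesis
  proof
    assume "free_chord 0 m"
    then obtain c where "valid_on c 0 (Suc m)" "c 0 \<noteq> None" "c m \<noteq> None" "c (Suc 0) \<noteq> None" "c (m - 1) \<noteq> None"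
      by (auto simp: free_chord_def)
    then have "free_piece L" unfolding free_piece_def using good_on[of c] val[of c] by metis
    then show ?thesis ..
  next
    assume "tight_chord 0 m"
    then have "tight_piece L" unfolding tight_piece_def tight_chord_def using good_on val by metis
    then show ?thesis ..
  qed
qed


section \<open>Fitting together the two sides of a chord\<close>

lemma neighbours3:
  assumes "E v x" "E v y" "E v z" "E v w" "distinct [x, y, z]"
  shows "w = x \<or> w = y \<or> w = z"
proof (rule ccontr)
  assume "\<not> ?thesis"
  then have "card {w, x, y, z} = 4" using assms(5) by auto
  moreover have "card {w, x, y, z} \<le> card {y. E v y}" using assms finite_neighbours by (intro card_mono) auto
  ultimately show False using degree[of v] by simp
qed

text \<open>An edge from \<open>P\<close> to \<open>R\<close> would cross \<open>ab\<close>. The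
  third neighbours of \<open>a\<close> and \<open>b\<close> are the ends of \<open>R\<close>, hence
  outside the piece.\<close>

lemma chord_piece_free_or_tight:
  assumes cyc: "cyc (a # P @ b # R)" and V: "set (a # P @ b # R) = V" and ab: "E a b" and ne: "P \<noteq> []" "R \<noteq> []"
  shows "free_piece (a # P @ [b]) \<or> tight_piece (a # P @ [b])"
proof (rule piece_free_or_tight[OF _ refl ne(1) ab, of R])
  show "cyc ((a # P @ [b]) @ R)" using cyc by simp
  have d: "distinct (a # P @ b # R)" and s: "successively E (a # P @ b # R)" "E (last R) a"
    using cyc ne by (auto simp: cyc_def)
  have e: "E a (hd P)" "E (last P) b" "E b (hd R)"
    using s(1) ne by (auto simp: successively_Cons successively_append_iff)
  have hl: "hd P \<in> set P" "last P \<in> set P" "hd R \<in> set R" "last R \<in> set R" using ne by auto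
  show "y \<in> set (a # P @ [b])" if xy: "x \<in> set P" "E x y" for x y
  proof (rule ccontr)
    assume "y \<notin> set (a # P @ [b])"
    moreover have "y \<in> V" using that E_V E_V2 by blast
    ultimately have "y \<in> set R" using V by auto
    then obtain r0 r1 where R: "R = r0 @ y # r1" by (meson split_list)
    obtain p0 p1 where P: "P = p0 @ x # p1" using xy(1) by (meson split_list)
    show False using cyc_crossing[of a p0 x p1 b r0 y r1] cyc P R ab xy(2) by simp
  qed
  show "y = hd P \<or> y = b" if "E a y" "y \<in> set (a # P @ [b])" for y
  proof -
    have "distinct [hd P, b, last R]" using d hl by auto
    then have "y = hd P \<or> y = b \<or> y = last R"
      using neighbours3[OF e(1) ab E_sym[OF s(2)] that(1)] by simp
    then show ?thesis using d hl that(2) by auto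
  qed
  show "y = last P \<or> y = a" if "E b y" "y \<in> set (a # P @ [b])" for y
  proof -
    have "distinct [last P, a, hd R]" using d hl by auto
    then have "y = last P \<or> y = a \<or> y = hd R"
      using neighbours3[OF E_sym[OF e(2)] E_sym[OF ab] e(3) that(1)] by simp
    then show ?thesis using d hl that(2) by auto
  qed
qed

text \<open>Every edge lies within one of the two sides, as none joins \<open>P\<close> to
  \<open>R\<close>. Only \<open>a\<close> and \<open>b\<close> have neighbours strictly on both
  sides, and there \<open>na\<close> and \<open>adj\<close> exclude two \<open>None\<close>
  neighbours.\<close>

lemma combine_pieces:
  assumes cyc: "cyc (a # P @ b # R)" and V: "set (a # P @ b # R) = V" and ab: "E a b" and ne: "P \<noteq> []" "R \<noteq> []"
    and f: "good_on f (set (a # P @ [b]))" and g: "good_on g (set (b # R @ [a]))" and fg: "f a = g a" "f b = g b"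
    and na: "\<not> (f (hd P) = None \<and> g (last R) = None)" and adj: "\<not> (f (last P) = None \<and> g (hd R) = None)"
  shows "\<exists>h. good_on h V"
proof -
  define h where "h v = (if v \<in> set P then f v else g v)" for v
  have d: "distinct (a # P @ b # R)" and s: "successively E (a # P @ b # R)" "E (last R) a"
    using cyc ne by (auto simp: cyc_def)
  have e: "E a (hd P)" "E (last P) b" "E b (hd R)"
    using s(1) ne by (auto simp: successively_Cons successively_append_iff)
  have hl: "hd P \<in> set P" "last P \<in> set P" "hd R \<in> set R" "last R \<in> set R" using ne by auto
  let ?S = "set (a # P @ [b])" and ?T = "set (b # R @ [a])"
  have hf: "h v = f v" if "v \<in> ?S" for v using that fg d by (auto simp: h_def)
  have hg: "h v = g v" if "v \<in> ?T" for v using that fg d by (auto simp: h_def)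
  have fS: "good_on h ?S" using f unfolding good_on_def by (simp only: hf cong: ball_cong)
  have gT: "good_on h ?T" using g unfolding good_on_def by (simp only: hg cong: ball_cong)
  have PR: "\<not> E x y" if x: "x \<in> set P" and y: "y \<in> set R" for x y
  proof
    assume "E x y"
    obtain r0 r1 where R: "R = r0 @ y # r1" using y by (meson split_list)
    obtain p0 p1 where P: "P = p0 @ x # p1" using x by (meson split_list)
    show False using cyc_crossing[of a p0 x p1 b r0 y r1] cyc P R ab \<open>E x y\<close> by simp
  qed
  have nbrs_a: "y = hd P \<or> y = b \<or> y = last R" if "E a y" for y
  proof -
    have "distinct [hd P, b, last R]" using d hl by auto
    then show ?thesis using neighbours3[OF e(1) ab E_sym[OF s(2)] that] by blast
  qed
  have nbrs_b: "y = last P \<or> y = a \<or> y = hd R" if "E b y" for y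
  proof -
    have "distinct [last P, a, hd R]" using d hl by auto
    then show ?thesis using neighbours3[OF E_sym[OF e(2)] E_sym[OF ab] e(3) that] by blast
  qed
  have cover: "x \<in> set P \<or> x \<in> set R \<or> x = a \<or> x = b" if "x \<in> V" for x
    using that unfolding V[symmetric] by auto
  have 1: "h x \<noteq> h y" if "E x y" for x y
  proof -
    have "x \<in> V" "y \<in> V" using that E_V E_V2 by blast+
    then have "x \<in> ?S \<and> y \<in> ?S \<or> x \<in> ?T \<and> y \<in> ?T"
      using cover[of x] cover[of y] PR[of x y] PR[of y x] that E_sym[OF that] by auto
    then show ?thesis using good_onD_proper[OF fS that] good_onD_proper[OF gT that] by blast
  qed
  have 2: "y = z" if xyz: "E x y" "E x z" "h y = None" "h z = None" for x y z
  proof -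
    have v: "x \<in> V" "y \<in> V" "z \<in> V" using xyz E_V E_V2 by blast+
    have S2: "y = z" if "x \<in> ?S" "y \<in> ?S" "z \<in> ?S" using good_onD_far[OF fS xyz(1,2) that xyz(3,4)] .
    have T2: "y = z" if "x \<in> ?T" "y \<in> ?T" "z \<in> ?T" using good_onD_far[OF gT xyz(1,2) that xyz(3,4)] .
    have ends: "hd P \<in> ?S" "last P \<in> ?S" "hd R \<in> ?T" "last R \<in> ?T" "a \<in> ?S" "b \<in> ?S" "a \<in> ?T" "b \<in> ?T"
      using hl by auto
    from cover[OF v(1)] show ?thesis
    proof (elim disjE)
      assume x: "x \<in> set P"
      then have "y \<in> ?S" "z \<in> ?S" "x \<in> ?S" using cover[OF v(2)] cover[OF v(3)] PR[of x y] PR[of x z] xyz by auto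
      then show ?thesis using S2 by blast
    next
      assume x: "x \<in> set R"
      then have "y \<in> ?T" "z \<in> ?T" "x \<in> ?T"
        using cover[OF v(2)] cover[OF v(3)] PR[of y x] PR[of z x] E_sym[OF xyz(1)] E_sym[OF xyz(2)] by auto
      then show ?thesis using T2 by blast
    next
      assume x: "x = a"
      have "\<not> (h (hd P) = None \<and> h (last R) = None)" using na hf hg ends by simp
      then show ?thesis using nbrs_a[of y] nbrs_a[of z] xyz S2 T2 ends unfolding x by metis
    next
      assume x: "x = b"
      have "\<not> (h (last P) = None \<and> h (hd R) = None)" using adj hf hg ends by simp
      then show ?thesis using nbrs_b[of y] nbrs_b[of z] xyz S2 T2 ends unfolding x by metis
    qed
  qed
  have "good_on h V" unfolding good_on_def using 1 2 by blast
  then show ?thesis by (intro exI)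
qed

lemma good_swap_edge:
  assumes "good_on f T" "E x y" "x \<in> T" "y \<in> T" "f x \<noteq> None" "f y \<noteq> None"
  obtains g where "good_on g T" "g x = Some True" "g y = Some False" "\<And>y. g y = None \<longleftrightarrow> f y = None"
proof -
  obtain g where g: "good_on g T" "g x = Some True" "\<And>y. g y = None \<longleftrightarrow> f y = None"
    using good_swap_to[OF assms(1,5)] by blast
  moreover have "g y = Some False" using good_onD_proper[OF g(1) assms(2-4)] g(2) g(3)[of y] assms(6) by auto
  ultimately show ?thesis using that by blast
qed

text \<open>If one side is free, its colouring fits any colouring of the other side with Boolean
  colours at \<open>a\<close> and \<open>b\<close>, normalised to \<open>True\<close> and
  \<open>False\<close>. If both sides are tight, both are coloured with \<open>None\<close> at
  \<open>a\<close>.\<close>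

lemma combine_chord:
  assumes cyc: "cyc (a # P @ b # R)" and V: "set (a # P @ b # R) = V" and ab: "E a b" and ne: "P \<noteq> []" "R \<noteq> []"
  shows "\<exists>h. good_on h V"
proof -
  have ba: "E b a" using ab E_sym by blast
  have cyc': "cyc (b # R @ a # P)" using cyc_rotate[of "a # P" "b # R"] cyc by simp
  have V': "set (b # R @ a # P) = V" using V by auto
  let ?S = "set (a # P @ [b])" and ?T = "set (b # R @ [a])"
  have e: "E a (hd P)" "E (last P) b" "E b (hd R)" "E (last R) a"
    using cyc ne by (auto simp: cyc_def successively_Cons successively_append_iff)
  have d: "distinct (a # P @ b # R)" using cyc by (simp add: cyc_def)
  have hl: "hd P \<in> set P" "last P \<in> set P" "hd R \<in> set R" "last R \<in> set R" using ne by auto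
  have PS: "\<exists>f. good_on f ?S \<and> f a = Some True \<and> f b = Some False \<and> f (hd P) \<noteq> None \<and> f (last P) \<noteq> None"
    if p: "free_piece (a # P @ [b])"
  proof -
    obtain f where "good_on f ?S" "f a \<noteq> None" "f b \<noteq> None" "f (hd P) \<noteq> None" "f (last P) \<noteq> None"
      using p ne by (auto simp: free_piece_def butlast_append)
    moreover from this obtain g where "good_on g ?S" "g a = Some True" "g b = Some False" "\<And>y. g y = None \<longleftrightarrow> f y = None"
      using good_swap_edge[of f ?S a b] ab by auto
    ultimately show ?thesis by metis
  qed
  have PT: "\<exists>f. good_on f ?T \<and> f a = Some True \<and> f b = Some False \<and> f (hd R) \<noteq> None \<and> f (last R) \<noteq> None"
    if p: "free_piece (b # R @ [a])"
  proof -
    obtain f where "good_on f ?T" "f b \<noteq> None" "f a \<noteq> None" "f (hd R) \<noteq> None" "f (last R) \<noteq> None"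
      using p ne by (auto simp: free_piece_def butlast_append)
    moreover from this obtain g where "good_on g ?T" "g a = Some True" "g b = Some False" "\<And>y. g y = None \<longleftrightarrow> f y = None"
      using good_swap_edge[of f ?T a b] ab by auto
    ultimately show ?thesis by metis
  qed
  have QS: "\<exists>f. good_on f ?S \<and> f a = Some True \<and> f b = Some False" if p: "tight_piece (a # P @ [b])"
  proof -
    obtain f where "good_on f ?S" "f a \<noteq> None" "f b \<noteq> None"
      using p by (auto simp: tight_piece_def)
    then show ?thesis using good_swap_edge[of f ?S a b] ab by (metis list.set_intros(1) in_set_conv_decomp append_Cons)
  qed
  have QT: "\<exists>f. good_on f ?T \<and> f a = Some True \<and> f b = Some False" if p: "tight_piece (b # R @ [a])"
  proof -
    obtain f where "good_on f ?T" "f b \<noteq> None" "f a \<noteq> None"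
      using p by (auto simp: tight_piece_def)
    then show ?thesis using good_swap_edge[of f ?T a b] ab by (metis list.set_intros(1) in_set_conv_decomp append_Cons)
  qed
  note combine_pieces' = combine_pieces[OF cyc V ab ne]
  show ?thesis
  proof (cases "free_piece (a # P @ [b])")
    case True
    obtain f where f: "good_on f ?S" "f a = Some True" "f b = Some False" "f (hd P) \<noteq> None" "f (last P) \<noteq> None"
      using PS True by blast
    obtain g where g: "good_on g ?T" "g a = Some True" "g b = Some False"
      using chord_piece_free_or_tight[OF cyc' V' ba ne(2,1)] PT QT by blast
    show ?thesis by (rule combine_pieces'[OF f(1) g(1)]) (use f g in auto)
  next
    case False
    then have Q: "tight_piece (a # P @ [b])" using chord_piece_free_or_tight[OF cyc V ab ne] by blast
    show ?thesis
    proof (cases "free_piece (b # R @ [a])")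
      case True
      obtain f where f: "good_on f ?S" "f a = Some True" "f b = Some False" using QS Q by blast
      obtain g where g: "good_on g ?T" "g a = Some True" "g b = Some False" "g (hd R) \<noteq> None" "g (last R) \<noteq> None"
        using PT True by blast
      show ?thesis by (rule combine_pieces'[OF f(1) g(1)]) (use f g in auto)
    next
      case False
      then have Q': "tight_piece (b # R @ [a])" using chord_piece_free_or_tight[OF cyc' V' ba ne(2,1)] by blast
      obtain f0 where f0: "good_on f0 ?S" "f0 b \<noteq> None" "f0 a = None" using Q by (auto simp: tight_piece_def)
      obtain g0 where g0: "good_on g0 ?T" "g0 b \<noteq> None" "g0 a = None" using Q' by (auto simp: tight_piece_def)
      obtain f where f: "good_on f ?S" "f b = Some True" "f a = None" using good_swap_to[OF f0(1,2)] f0(3) by metis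
      obtain g where g: "good_on g ?T" "g b = Some True" "g a = None" using good_swap_to[OF g0(1,2)] g0(3) by metis
      \<comment> \<open>As \<open>a\<close> has colour \<open>None\<close>, its neighbour
        \<open>hd P\<close> cannot have it, nor can \<open>last P\<close>, which shares the
        neighbour \<open>b\<close> with \<open>a\<close>.\<close>
      have "f (hd P) \<noteq> None" using good_onD_proper[OF f(1) e(1)] f(3) hl by auto
      moreover have "f (last P) \<noteq> None"
        using good_onD_far[OF f(1) ba E_sym[OF e(2)]] f(3) hl d by auto
      ultimately show ?thesis by (intro combine_pieces'[OF f(1) g(1)]) (use f g in auto)
    qed
  qed
qed

text \<open>If no Hamiltonian cycle has a chord, the whole cycle is a single piece, with the edge
  between its last and first vertex in place of the chord.\<close>

theorem good_on_V_exists: "\<exists>f. good_on f V"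
proof (cases "\<exists>a P b R. cyc (a # P @ b # R) \<and> set (a # P @ b # R) = V \<and> E a b \<and> P \<noteq> [] \<and> R \<noteq> []")
  case True
  then show ?thesis using combine_chord by blast
next
  case no_chord: False
  obtain xs where xs: "cyc xs" "set xs = V" using hamiltonian by blast
  then have l: "3 \<le> length xs" by (simp add: cyc_def)
  obtain a ys where "xs = a # ys" using l by (cases xs) auto
  moreover from this obtain P b where "ys = P @ [b]" using l by (cases ys rule: rev_cases) auto
  ultimately have L: "xs = a # P @ [b]" "P \<noteq> []" using l by auto
  have ab: "E a b" using xs(1) E_sym by (auto simp: L cyc_def)
  have "free_piece xs \<or> tight_piece xs"
  proof (rule piece_free_or_tight[OF _ L ab, of "[]"])
    show "cyc (xs @ [])" using xs by simp
    show "y \<in> set xs" if "E x y" for x y using that E_V2 xs(2) by blast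
    show "y = hd P \<or> y = b" if y: "E a y" "y \<in> set xs" for y
    proof (rule ccontr)
      assume neg: "\<not> ?thesis"
      then have "y \<in> set P" using y E_irrefl by (auto simp: L)
      then obtain p0 p1 where P: "P = p0 @ y # p1" by (meson split_list)
      have "p0 \<noteq> []" using neg P by auto
      moreover have "cyc (a # p0 @ y # (p1 @ [b]))" "set (a # p0 @ y # (p1 @ [b])) = V" using xs by (auto simp: L P)
      ultimately show False using no_chord y(1) by blast
    qed
    show "y = last P \<or> y = a" if y: "E b y" "y \<in> set xs" for y
    proof (rule ccontr)
      assume neg: "\<not> ?thesis"
      then have "y \<in> set P" using y E_irrefl by (auto simp: L)
      then obtain p0 p1 where P: "P = p0 @ y # p1" by (meson split_list)
      have "p1 \<noteq> []" using neg P by auto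
      moreover have "cyc (b # (a # p0) @ y # p1)" using cyc_rotate[of "a # P" "[b]"] xs by (simp add: L P)
      moreover have "set (b # (a # p0) @ y # p1) = V" using xs by (auto simp: L P)
      ultimately show False using no_chord y(1) by blast
    qed
  qed
  then show ?thesis using xs(2) by (auto simp: free_piece_def tight_piece_def)
qed

end

section \<open>Packing colouring\<close>

context graph begin

lemma card_dominated: "card {y. x \<rightarrow>\<^bsub>G\<^esub> y} \<le> out_degree G x"
proof -
  have "{y. x \<rightarrow>\<^bsub>G\<^esub> y} = head G ` out_arcs G x" by (auto simp: arcs_ends_conv out_arcs_def)
  then show ?thesis by (simp add: out_degree_def card_image_le finite_out_arcs)
qed

text \<open>Connectedness is defined through the symmetrised digraph; as the arcs of
  \<open>G\<close> are symmetric, each step there is an arc of \<open>G\<close> that avoids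
  \<open>v\<close>.\<close>

lemma connected_del_vert_walk:
  assumes "Digraph_Component.connected (del_vert v)" "x \<in> verts G" "y \<in> verts G" "x \<noteq> v" "y \<noteq> v"
  shows "(\<lambda>x y. x \<rightarrow>\<^bsub>G\<^esub> y \<and> x \<noteq> v \<and> y \<noteq> v)\<^sup>*\<^sup>* x y"
proof -
  let ?H = "mk_symmetric (del_vert v)"
  have "x \<rightarrow>\<^sup>*\<^bsub>with_proj ?H\<^esub> y"
    using assms unfolding Digraph_Component.connected_def strongly_connected_def
    by (simp add: verts_del_vert)
  then have "(x, y) \<in> rtrancl_on (verts (with_proj ?H)) (arcs_ends (with_proj ?H))"
    by (simp add: reachable_def)
  then show ?thesis
  proof (induction rule: rtrancl_on_induct)
    case (step y z)
    have "y \<rightarrow>\<^bsub>G\<^esub> z \<and> y \<noteq> v \<and> z \<noteq> v"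
      using step(2) arcs_ends_symmetric[OF sym_arcs]
      by (auto simp: parcs_mk_symmetric del_vert_def arcs_ends_conv)
    then show ?case using step(5) by (rule_tac rtranclp.rtrancl_into_rtrancl)
  qed simp
qed

lemma graph_dist_ge:
  assumes "\<And>p. awalk x p y \<Longrightarrow> k \<le> length p"
  shows "graph_dist G x y \<ge> ereal (real k)"
  unfolding graph_dist_def \<mu>_def
proof (rule INF_greatest)
  fix p assume "p \<in> {p. awalk x p y}"
  moreover have "awalk_cost (\<lambda>_. 1) p = real (length p)" by (induction p) auto
  ultimately show "ereal (real k) \<le> ereal (awalk_cost (\<lambda>_. 1) p)" using assms by simp
qed

text \<open>Walks of length one within a class are excluded by \<open>proper\<close>. The middle
  vertex of a walk of length two between two vertices of the third class would have two neighbours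
  coloured \<open>None\<close>, against \<open>far\<close>.\<close>

lemma packing_colorable_112:
  fixes f :: "'a \<Rightarrow> bool option"
  assumes proper: "\<And>x y. x \<rightarrow>\<^bsub>G\<^esub> y \<Longrightarrow> f x \<noteq> f y"
    and far: "\<And>x y z. x \<rightarrow>\<^bsub>G\<^esub> y \<Longrightarrow> x \<rightarrow>\<^bsub>G\<^esub> z \<Longrightarrow> f y = None \<Longrightarrow> f z = None \<Longrightarrow> y = z"
  shows "packing_colorable G [1, 1, 2]"
proof -
  \<comment> \<open>The class \<open>None\<close> comes last, to match the entry
    \<open>2\<close>.\<close>
  define V where "V i = {v \<in> verts G. f v = [Some True, Some False, None] ! i}" for i :: nat
  have less3: "i < 3 \<longleftrightarrow> i = 0 \<or> i = 1 \<or> i = 2" for i :: nat by auto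
  have V: "V 0 = {v \<in> verts G. f v = Some True}" "V 1 = {v \<in> verts G. f v = Some False}"
    "V 2 = {v \<in> verts G. f v = None}" by (simp_all add: V_def)
  have "f v = Some True \<or> f v = Some False \<or> f v = None" for v by (cases "f v") auto
  moreover have three: "{..<3} = {0, 1, 2 :: nat}" by auto
  ultimately have "(\<Union>i<3. V i) = verts G" by (simp only: three V UN_insert UN_empty) blast
  moreover have "disjoint_family_on V {..<3}"
    unfolding disjoint_family_on_def three by (auto simp: V_def)
  moreover have "graph_dist G x y \<ge> ereal (real ([1, 1, 2] ! i + 1))"
    if "i < 3" "x \<in> V i" "y \<in> V i" "x \<noteq> y" for i x y
  proof (rule graph_dist_ge)
    fix p assume p: "awalk x p y"
    have l0: "length p \<noteq> 0" using p that by (auto simp: awalk_Nil_iff)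
    have l1: "length p \<noteq> 1"
    proof
      assume "length p = 1"
      then obtain e where "p = [e]" by (cases p) auto
      then have "x \<rightarrow>\<^bsub>G\<^esub> y" using p by (auto simp: awalk_Cons_iff awalk_Nil_iff arcs_ends_conv)
      then show False using proper[of x y] that(2,3) by (simp add: V_def)
    qed
    have l2: "length p \<noteq> 2" if "i = 2"
    proof
      assume "length p = 2"
      then obtain d e where "p = [d, e]" by (cases p; cases "tl p") auto
      then have "x \<rightarrow>\<^bsub>G\<^esub> head G d" "head G d \<rightarrow>\<^bsub>G\<^esub> y"
        using p by (auto simp: awalk_Cons_iff awalk_Nil_iff arcs_ends_conv)
      then show False
        using far[of "head G d" x y] arcs_ends_symmetric[OF sym_arcs, of x] \<open>x \<in> V i\<close> \<open>y \<in> V i\<close> \<open>x \<noteq> y\<close> \<open>i = 2\<close> V(3)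
        by simp
    qed
    have "2 \<le> length p" using l0 l1 by linarith
    moreover have "3 \<le> length p" if "i = 2" using l0 l1 l2[OF that] by linarith
    ultimately show "[1, 1, 2] ! i + 1 \<le> length p"
      using \<open>i < 3\<close> unfolding less3 by auto
  qed
  ultimately show ?thesis unfolding packing_colorable_def packing_coloring_def
    by (intro exI[of _ V]) (simp add: numeral_3_eq_3)
qed

end

theorem theorem4:
  fixes G :: "('a, 'b) pre_digraph"
  assumes "graph G"
    and "two_connected G"
    and "subcubic G"
    and "outerplanar G"
  shows "packing_colorable G [1, 1, 2]"
proof -
  interpret graph G by fact
  define E where "E x y \<longleftrightarrow> x \<rightarrow>\<^bsub>G\<^esub> y" for x y
  have sym: "E x y \<Longrightarrow> E y x" for x y
    unfolding E_def by (rule arcs_ends_symmetric[OF sym_arcs])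
  have irrefl: "\<not> E x x" for x unfolding E_def using adj_not_same by blast
  have inV: "E x y \<Longrightarrow> x \<in> verts G" for x y unfolding E_def by (auto simp: arcs_ends_conv)
  obtain p \<gamma> where draw: "plane_drawing G p \<gamma>"
    and outer: "p ` verts G \<subseteq> frontier (outside (drawing_points G p \<gamma>))"
    using assms(4) by (auto simp: outerplanar_def)
  have edge: "{x, y} \<in> edges G" if "E x y" for x y using that by (auto simp: edges_def E_def)
  have inj: "inj_on p (verts G)" using draw by (simp add: plane_drawing_def)
  interpret O: outerplane_drawing "verts G" E p \<gamma> "drawing_points G p \<gamma>"
  proof
    show "E x y \<Longrightarrow> E y x" for x y by (rule sym)
    show "\<not> E x x" for x by (rule irrefl)
    show "E x y \<Longrightarrow> x \<in> verts G" for x y by (rule inV)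
    show "inj_on p (verts G)" by (rule inj)
    show "Path_Connected.arc (\<gamma> {x, y})" if "E x y" for x y
      using draw edge[OF that] by (simp add: plane_drawing_def)
    show "{pathstart (\<gamma> {x, y}), pathfinish (\<gamma> {x, y})} = {p x, p y}" if "E x y" for x y
      using draw edge[OF that] by (simp add: plane_drawing_def)
    show "path_image (\<gamma> {x, y}) \<inter> path_image (\<gamma> {u, v}) \<subseteq> p ` ({x, y} \<inter> {u, v})"
      if "E x y" "E u v" "{x, y} \<noteq> {u, v}" for x y u v
    proof -
      have dis: "(path_image (\<gamma> e) - p ` e) \<inter> path_image (\<gamma> f) = {}" if "e \<in> edges G" "f \<in> edges G" "f \<noteq> e" for e f
        using draw that by (simp add: plane_drawing_def)
      \<comment> \<open>Disjointness used in both directions: a common point is an end of each of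
        the two edges.\<close>
      have "path_image (\<gamma> {x, y}) \<inter> path_image (\<gamma> {u, v}) \<subseteq> p ` {x, y} \<inter> p ` {u, v}"
        using dis[OF edge[OF that(1)] edge[OF that(2)]] dis[OF edge[OF that(2)] edge[OF that(1)]] that(3) by blast
      also have "\<dots> = p ` ({x, y} \<inter> {u, v})"
        by (rule inj_on_image_Int[OF inj, symmetric]) (use that inV sym in blast)+
      finally show ?thesis .
    qed
    show "path_image (\<gamma> {x, y}) \<subseteq> drawing_points G p \<gamma>" if "E x y" for x y
      using edge[OF that] by (auto simp: drawing_points_def)
    show "x \<in> verts G \<Longrightarrow> p x \<in> frontier (outside (drawing_points G p \<gamma>))" for x
      using outer by blast
  qed
  \<comment> \<open>The axioms \<open>no_theta\<close> and \<open>no_crossing\<close> do not mention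
    the vertex set, so membership is read off from the edges of the paths.\<close>
  have path_V: "set (a # xs @ [b]) \<subseteq> verts G" if "successively E (a # xs @ [b])" for a b xs
    using that
  proof (induction xs arbitrary: a)
    case Nil
    then show ?case using inV[of a b] inV[of b a] sym[of a b] by auto
  next
    case (Cons x xs)
    then show ?case using inV by auto
  qed
  interpret outerplanar_graph "verts G" E
  proof
    show "finite (verts G)" by simp
    show "3 \<le> card (verts G)" using assms(2) by (simp add: two_connected_def)
    show "E x y \<Longrightarrow> E y x" for x y by (rule sym)
    show "\<not> E x x" for x by (rule irrefl)
    show "E x y \<Longrightarrow> x \<in> verts G" for x y by (rule inV)
    show "card {y. E x y} \<le> 3" for x
    \<comment> \<open>\<open>subcubic\<close> bounds degrees of vertices only; any other
      \<open>x\<close> has no neighbours.\<close>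
    proof (cases "x \<in> verts G")
      case True
      then show ?thesis using card_dominated[of x] assms(3) unfolding E_def subcubic_def by (meson le_trans)
    next
      case False
      then have "{y. E x y} = {}" using inV by blast
      then show ?thesis by simp
    qed
    show "(\<lambda>x y. E x y \<and> x \<noteq> v \<and> y \<noteq> v)\<^sup>*\<^sup>* x y"
      if "v \<in> verts G" "x \<in> verts G" "y \<in> verts G" "x \<noteq> v" "y \<noteq> v" for v x y
      using connected_del_vert_walk[of v x y] assms(2) that unfolding E_def two_connected_def by blast
    show "zs = []" if "distinct (a # b # xs @ ys @ zs)" "successively E (a # xs @ [b])"
      "successively E (a # ys @ [b])" "successively E (a # zs @ [b])" "xs \<noteq> []" "ys \<noteq> []" for a b xs ys zs
      by (rule O.theta_chord(1)[OF that]) (use path_V[OF that(2)] path_V[OF that(3)] path_V[OF that(4)] in auto)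
    show False if "distinct (a # c # xs @ b # xs' @ ys @ d # ys')" "successively E (a # xs @ b # xs' @ [c])"
      "successively E (a # ys @ d # ys' @ [c])" "E a c" "E b d" for a b c d xs xs' ys ys'
      by (rule O.no_crossing[OF that(1-3) _ that(4,5)])
        (use path_V[of a "xs @ b # xs'" c] path_V[of a "ys @ d # ys'" c] that in auto)
  qed
  obtain f where f: "good_on f (verts G)" using good_on_V_exists by blast
  show ?thesis
  proof (rule packing_colorable_112)
    show "f x \<noteq> f y" if "x \<rightarrow>\<^bsub>G\<^esub> y" for x y
      using good_onD_proper[OF f] that inV sym by (metis E_def)
    show "y = z" if "x \<rightarrow>\<^bsub>G\<^esub> y" "x \<rightarrow>\<^bsub>G\<^esub> z" "f y = None" "f z = None" for x y z
      using good_onD_far[OF f] that inV sym by (metis E_def)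
  qed
qed

end
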